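(* Let $S$ be a $\mathrm{Cu}$-semigroup satisfying (O5), (O6) and (O7), and let $\lambda\in F(S)$. Suppose that for all $x,y\in S$ with $\lambda(x)<\infty$ and $\lambda(y)<\infty$ we have $$(\widehat{x}\wedge\widehat{y})(\lambda)\leq\sup\{\lambda(z) : z\in S,\ z\leq x,\ z\leq y\}.$$ Then $S$ satisfies Edwards' condition for $\lambda$, that is, $$\inf\big\{\lambda_1(x)+\lambda_2(y):\lambda_1,\lambda_2\in F(S),\ \lambda=\lambda_1+\lambda_2\big\}=\sup\{\lambda(z) : z\in S,\ z\leq x,\ z\leq y\}$$ for all $x,y\in S$.
   Context: A positively ordered monoid is a commutative monoid with a partial order compatible with addition such that $0\leq x$ for all $x$. In an ordered set where increasing sequences have suprema, $x\ll y$ means: whenever $(y_n)_n$ is increasing with $y\leq\sup_n y_n$, there is $n_0$ with $x\leq y_{n_0}$. A $\mathrm{Cu}$-semigroup is a positively ordered monoid $S$ such that: (O1) every increasing sequence has a supremum; (O2) every $x\in S$ is the supremum of some $\ll$-increasing sequence; (O3) $x_1\ll y_1$ and $x_2\ll y_2$ imply $x_1+x_2\ll y_1+y_2$; (O4) $\sup_n(x_n+y_n)=\sup_n x_n+\sup_n y_n$ for increasing sequences $(x_n)_n,(y_n)_n$. Further properties: (O5) for all $x'\ll x\leq y$ and $w'\ll w$ with $x+w\leq y$ there is $z$ with $x'+z\leq y\leq x+z$ and $w'\ll z$; (O6) for all $x'\ll x\leq y+z$ there are $y',z'$ with $x'\leq y'+z'$, $y'\leq x,y$ and $z'\leq x,z$;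 (O7) whenever $x_1'\ll x_1\leq w$ and $x_2'\ll x_2\leq w$, there is $x$ with $x_1',x_2'\ll x$ and $x\leq w$, $x\leq x_1+x_2$. A functional on $S$ is a map $\lambda\colon S\to[0,\infty]$ with $\lambda(0)=0$ preserving addition, order and suprema of increasing sequences; $F(S)$ is the set of functionals, with pointwise addition. For $x\in S$, $\widehat{x}\colon F(S)\to[0,\infty]$ is $\widehat{x}(\lambda)=\lambda(x)$. When $S$ satisfies (O5) and (O6), the infimum $\widehat{x}\wedge\widehat{y}$, taken among linear maps $F(S)\to[0,\infty]$ with the pointwise order, is given by $(\widehat{x}\wedge\widehat{y})(\lambda)=\inf\{\lambda_1(x)+\lambda_2(y):\lambda_1,\lambda_2\in F(S),\ \lambda=\lambda_1+\lambda_2\}$. *)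

theory Defs
  imports "HOL-Analysis.Analysis"
begin

section \<open>Cu-semigroups\<close>

definition (in order) is_seq_sup :: "(nat \<Rightarrow> 'a) \<Rightarrow> 'a \<Rightarrow> bool" where
  "is_seq_sup X s \<longleftrightarrow> (\<forall>n. X n \<le> s) \<and> (\<forall>u. (\<forall>n. X n \<le> u) \<longrightarrow> s \<le> u)"

text \<open>The supremum is a relation because the type need not be complete. Without (O1), increasing
  sequences that have no supremum impose no condition on \<open>\<lless>\<close>; in a Cu-semigroup there are none.
  Inside the class context, \<open>monotone (\<le>) (\<le>) X\<close> is what \<open>incseq X\<close> abbreviates.\<close>

definition (in order) way_below :: "'a \<Rightarrow> 'a \<Rightarrow> bool" (infix \<open>\<lless>\<close> 50) where
  "x \<lless> y \<longleftrightarrow> (\<forall>Y s. monotone (\<le>) (\<le>) Y \<and> is_seq_sup Y s \<and> y \<le> s \<longrightarrow> (\<exists>n. x \<le> Y n))"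

class pos_ordered_monoid = ordered_comm_monoid_add +
  assumes pom_zero_le: "0 \<le> x"

class cu_semigroup = pos_ordered_monoid +
  assumes O1: "monotone (\<le>) (\<le>) X \<Longrightarrow> \<exists>s. is_seq_sup X s"
    and O2: "\<exists>X. (\<forall>n. X n \<lless> X (Suc n)) \<and> is_seq_sup X x"
    and O3: "x1 \<lless> y1 \<Longrightarrow> x2 \<lless> y2 \<Longrightarrow> x1 + x2 \<lless> y1 + y2"
    and O4: "monotone (\<le>) (\<le>) X \<Longrightarrow> monotone (\<le>) (\<le>) Y \<Longrightarrow> is_seq_sup X s \<Longrightarrow> is_seq_sup Y t \<Longrightarrow>
             is_seq_sup (\<lambda>n. X n + Y n) (s + t)"

definition cu_O5 :: "'a::cu_semigroup itself \<Rightarrow> bool" where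
  "cu_O5 _ \<longleftrightarrow> (\<forall>(x'::'a) x y w' w.
     x' \<lless> x \<and> x \<le> y \<and> w' \<lless> w \<and> x + w \<le> y \<longrightarrow>
     (\<exists>z. x' + z \<le> y \<and> y \<le> x + z \<and> w' \<lless> z))"

definition cu_O6 :: "'a::cu_semigroup itself \<Rightarrow> bool" where
  "cu_O6 _ \<longleftrightarrow> (\<forall>(x'::'a) x y z.
     x' \<lless> x \<and> x \<le> y + z \<longrightarrow>
     (\<exists>y' z'. x' \<le> y' + z' \<and> y' \<le> x \<and> y' \<le> y \<and> z' \<le> x \<and> z' \<le> z))"

definition cu_O7 :: "'a::cu_semigroup itself \<Rightarrow> bool" where
  "cu_O7 _ \<longleftrightarrow> (\<forall>(x1'::'a) x1 x2' x2 w.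
     x1' \<lless> x1 \<and> x1 \<le> w \<and> x2' \<lless> x2 \<and> x2 \<le> w \<longrightarrow>
     (\<exists>x. x1' \<lless> x \<and> x2' \<lless> x \<and> x \<le> w \<and> x \<le> x1 + x2))"

section \<open>Functionals\<close>

definition functionals :: "('a::cu_semigroup \<Rightarrow> ennreal) set" where
  "functionals = {l. l 0 = 0 \<and> (\<forall>x y. l (x + y) = l x + l y) \<and> mono l \<and>
     (\<forall>X s. incseq X \<and> is_seq_sup X s \<longrightarrow> l s = (SUP n. l (X n)))}"

definition hat :: "'a::cu_semigroup \<Rightarrow> ('a \<Rightarrow> ennreal) \<Rightarrow> ennreal" where
  "hat x l = l x"

text \<open>A linear map from the cone of functionals to \<open>[0,\<infinity>]\<close> is a function on all of
  \<open>'a \<Rightarrow> ennreal\<close>; only its values on \<open>functionals\<close> matter.\<close>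

definition linear_on_functionals :: "(('a::cu_semigroup \<Rightarrow> ennreal) \<Rightarrow> ennreal) \<Rightarrow> bool" where
  "linear_on_functionals f \<longleftrightarrow>
     f (\<lambda>_. 0) = 0 \<and>
     (\<forall>l\<in>functionals. \<forall>m\<in>functionals. f (\<lambda>x. l x + m x) = f l + f m) \<and>
     (\<forall>l\<in>functionals. \<forall>c::real. 0 < c \<longrightarrow> f (\<lambda>x. ennreal c * l x) = ennreal c * f l)"

definition is_linear_inf ::
  "(('a::cu_semigroup \<Rightarrow> ennreal) \<Rightarrow> ennreal) \<Rightarrow> (('a \<Rightarrow> ennreal) \<Rightarrow> ennreal) \<Rightarrow>
   (('a \<Rightarrow> ennreal) \<Rightarrow> ennreal) \<Rightarrow> bool" where
  "is_linear_inf f g h \<longleftrightarrow>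
     linear_on_functionals h \<and>
     (\<forall>l\<in>functionals. h l \<le> f l \<and> h l \<le> g l) \<and>
     (\<forall>k. linear_on_functionals k \<and> (\<forall>l\<in>functionals. k l \<le> f l \<and> k l \<le> g l) \<longrightarrow>
        (\<forall>l\<in>functionals. k l \<le> h l))"

text \<open>The choice below is immaterial on functionals, by the lemma that follows; it is meaningful
  only if the infimum exists, which for \<open>hat x\<close> and \<open>hat y\<close> is a consequence of (O5) and (O6).\<close>

definition linear_inf ::
  "(('a::cu_semigroup \<Rightarrow> ennreal) \<Rightarrow> ennreal) \<Rightarrow> (('a \<Rightarrow> ennreal) \<Rightarrow> ennreal) \<Rightarrow>
   (('a \<Rightarrow> ennreal) \<Rightarrow> ennreal)" where
  "linear_inf f g = (SOME h. is_linear_inf f g h)"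

lemma linear_inf_eq:
  assumes "is_linear_inf f g h" "l \<in> functionals"
  shows "linear_inf f g l = h l"
proof -
  have "is_linear_inf f g (linear_inf f g)"
    unfolding linear_inf_def using assms(1) by (rule someI[of "is_linear_inf f g"])
  then show ?thesis
    using assms unfolding is_linear_inf_def by (meson order_antisym)
qed

section \<open>Edwards' condition\<close>

definition edwards_condition :: "('a::cu_semigroup \<Rightarrow> ennreal) \<Rightarrow> bool" where
  "edwards_condition l \<longleftrightarrow> (\<forall>x y.
     Inf {l1 x + l2 y |l1 l2. l1 \<in> functionals \<and> l2 \<in> functionals \<and> l = (\<lambda>w. l1 w + l2 w)} =
     Sup {l z |z. z \<le> x \<and> z \<le> y})"

end

theory Submission
  imports Defs
begin

text \<open>For functionals \<open>a\<close> and \<open>l\<close> there is a least functional \<open>residual a l\<close> with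
  \<open>a \<le> l + residual a l\<close>, the positive part of \<open>a - l\<close>; it yields Riesz decomposition in the cone of
  functionals for values in \<open>[0,\<infinity>]\<close>. Hence \<open>l \<mapsto> inf {l1 x + l2 y | l = l1 + l2}\<close> is additive, so it is the
  infimum of the two evaluation maps among linear maps: in \<open>l + m = a + b\<close> split \<open>a = a1 + a2\<close> below
  \<open>l\<close> and \<open>m\<close>, make \<open>a1\<close>, \<open>a2\<close> infinite off the ideal of \<open>x\<close>, and take residuals of \<open>l\<close>, \<open>m\<close>;
  these add up to at most \<open>b\<close> at \<open>y\<close>.

  When \<open>l\<close> is infinite at \<open>x\<close> or \<open>y\<close>, decompositions that are good for the elements of finite value
  below \<open>x\<close> and \<open>y\<close>, which are directed by (O7), have a limit by Tychonoff's theorem. If the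
  supremum \<open>s\<close> is finite, then (O6) shows that an element below both \<open>n x + a\<close> and \<open>m y + b\<close> with \<open>a\<close>,
  \<open>b\<close> of finite value has finite value, so the two limit functionals may be made infinite off the ideals
  generated by \<open>x\<close>, respectively \<open>y\<close>, together with the elements of finite value.\<close>

section \<open>Compact containment and multiples\<close>

lemma way_below_imp_le: "(x::'a::order) \<lless> y \<Longrightarrow> x \<le> y"
  unfolding way_below_def is_seq_sup_def
  by (drule spec[of _ "\<lambda>_. y"], drule spec[of _ y]) (auto simp: monotone_on_def)

lemma way_below_trans1: "(x::'a::order) \<le> y \<Longrightarrow> y \<lless> z \<Longrightarrow> x \<lless> z"
  unfolding way_below_def by (meson order_trans)

lemma way_below_trans2: "(x::'a::order) \<lless> y \<Longrightarrow> y \<le> z \<Longrightarrow> x \<lless> z"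
  unfolding way_below_def by (meson order_trans)

lemma way_belowD:
  "(x::'a::order) \<lless> y \<Longrightarrow> incseq Y \<Longrightarrow> is_seq_sup Y s \<Longrightarrow> y \<le> s \<Longrightarrow> \<exists>n. x \<le> Y n"
  unfolding way_below_def by blast

lemma zero_way_below [simp]: "0 \<lless> (x::'a::cu_semigroup)"
  unfolding way_below_def by (simp add: pom_zero_le)

lemma is_seq_sup_upper: "is_seq_sup X s \<Longrightarrow> X n \<le> s"
  by (simp add: is_seq_sup_def)

lemma way_below_seq:
  obtains X where "incseq X" "\<And>n. X n \<lless> (x::'a::cu_semigroup)" "is_seq_sup X x"
proof -
  obtain X where X: "\<And>n. X n \<lless> X (Suc n)" "is_seq_sup X x" using O2[of x] by blast
  have "incseq X" using X(1) by (intro incseq_SucI way_below_imp_le)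
  moreover have "\<And>n. X n \<lless> x"
    using X by (meson is_seq_sup_upper way_below_trans2)
  ultimately show ?thesis using X(2) that by blast
qed

lemma way_below_interpolate:
  assumes "(x::'a::cu_semigroup) \<lless> z"
  obtains y where "x \<lless> y" "y \<lless> z"
proof -
  obtain X where X: "\<And>n. X n \<lless> X (Suc n)" "is_seq_sup X z" using O2[of z] by blast
  have "incseq X" using X(1) by (intro incseq_SucI way_below_imp_le)
  then obtain n where "x \<le> X n" using assms X(2) way_belowD by blast
  then show ?thesis
    using X by (meson is_seq_sup_upper way_below_trans1 way_below_trans2 that)
qed

text \<open>By (O4) the sums of two approximating sequences have supremum \<open>x + y\<close>, so
  one of these sums already dominates \<open>v\<close>.\<close>

lemma way_below_add_split:
  assumes "v \<lless> (x::'a::cu_semigroup) + y"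
  obtains x' y' where "x' \<lless> x" "y' \<lless> y" "v \<le> x' + y'"
proof -
  obtain X where X: "incseq X" "\<And>n. X n \<lless> x" "is_seq_sup X x" using way_below_seq[of x] by blast
  obtain Y where Y: "incseq Y" "\<And>n. Y n \<lless> y" "is_seq_sup Y y" using way_below_seq[of y] by blast
  have "is_seq_sup (\<lambda>n. X n + Y n) (x + y)" using O4 X Y by blast
  moreover have "incseq (\<lambda>n. X n + Y n)"
    using X(1) Y(1) by (simp add: incseq_def add_mono)
  ultimately obtain n where "v \<le> X n + Y n" using assms way_belowD by blast
  then show ?thesis using X Y that by blast
qed

lemma le_add_left: "(x::'a::cu_semigroup) \<le> x + y"
  using add_left_mono[OF pom_zero_le, of x y] by simp

lemma le_add_right: "(y::'a::cu_semigroup) \<le> x + y"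
  using le_add_left[of y x] by (simp add: add.commute)

primrec nmult :: "nat \<Rightarrow> 'a::cu_semigroup \<Rightarrow> 'a" (infixr \<open>\<odot>\<close> 75) where
  "0 \<odot> x = 0"
| "Suc n \<odot> x = x + n \<odot> x"

lemma nmult_one [simp]: "1 \<odot> x = x" "Suc 0 \<odot> x = x"
  by simp_all

lemma nmult_add: "n \<odot> (x + y) = n \<odot> x + n \<odot> y"
  by (induction n) (simp_all add: ac_simps)

lemma nmult_add_left: "(m + n) \<odot> x = m \<odot> x + n \<odot> x"
  by (induction m) (simp_all add: ac_simps)

lemma nmult_mult: "(m * n) \<odot> x = m \<odot> n \<odot> x"
  by (induction m) (simp_all add: nmult_add_left)

lemma nmult_zero [simp]: "n \<odot> 0 = 0"
  by (induction n) simp_all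

lemma nmult_mono: "x \<le> y \<Longrightarrow> n \<odot> x \<le> n \<odot> y"
  by (induction n) (simp_all add: add_mono)

lemma nmult_seq_sup: "incseq X \<Longrightarrow> is_seq_sup X s \<Longrightarrow> is_seq_sup (\<lambda>k. n \<odot> X k) (n \<odot> s)"
proof (induction n)
  case 0
  then show ?case by (simp add: is_seq_sup_def)
next
  case (Suc n)
  have "incseq (\<lambda>k. n \<odot> X k)" using Suc(2) by (simp add: incseq_def nmult_mono)
  with Suc show ?case by (simp add: O4)
qed

lemma way_below_nmult_split:
  assumes "v \<lless> n \<odot> x"
  obtains x' where "x' \<lless> x" "v \<le> n \<odot> x'"
proof -
  obtain X where X: "incseq X" "\<And>n. X n \<lless> x" "is_seq_sup X x" using way_below_seq[of x] by blast
  have "incseq (\<lambda>k. n \<odot> X k)" using X(1) by (simp add: incseq_def nmult_mono)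
  then obtain k where "v \<le> n \<odot> X k" using assms nmult_seq_sup[OF X(1,3)] way_belowD by blast
  with X(2) that show ?thesis by blast
qed

section \<open>Functionals\<close>

text \<open>The last assumption, continuity along \<open>\<lless>\<close>, yields preservation of
  suprema: if \<open>X\<close> increases to \<open>s\<close>, every \<open>x' \<lless> s\<close>
  lies below some \<open>X n\<close>.\<close>

lemma functionalsI:
  assumes "f 0 = 0" "\<And>x y. f (x + y) = f x + f y" "\<And>x y. x \<le> y \<Longrightarrow> f x \<le> f y"
    and "\<And>x c. (\<And>x'. x' \<lless> x \<Longrightarrow> f x' \<le> c) \<Longrightarrow> f x \<le> c"
  shows "f \<in> functionals"
proof -
  have "f s = (SUP n. f (X n))" if X: "incseq X" "is_seq_sup X s" for X s
  proof (rule antisym)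
    show "f s \<le> (SUP n. f (X n))"
    proof (rule assms(4))
      fix x' assume "x' \<lless> s"
      then obtain n where "x' \<le> X n" using way_belowD[OF _ X] by blast
      then show "f x' \<le> (SUP n. f (X n))" by (meson SUP_upper2 UNIV_I assms(3))
    qed
    show "(SUP n. f (X n)) \<le> f s" using X(2) by (intro SUP_least assms(3) is_seq_sup_upper)
  qed
  then show ?thesis unfolding functionals_def using assms(1-3) by (auto simp: mono_def)
qed

context
  fixes f :: "'a::cu_semigroup \<Rightarrow> ennreal"
  assumes f: "f \<in> functionals"
begin

lemma fn_zero: "f 0 = 0" and fn_add: "f (x + y) = f x + f y"
  and fn_mono: "x \<le> y \<Longrightarrow> f x \<le> f y"
  and fn_sup: "incseq X \<Longrightarrow> is_seq_sup X s \<Longrightarrow> f s = (SUP n. f (X n))"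
  using f unfolding functionals_def by (auto simp: mono_def)

lemma fn_le_add: "x \<le> y + z \<Longrightarrow> f x \<le> f y + f z"
  using fn_mono fn_add by metis

lemma fn_nmult: "f (n \<odot> x) = of_nat n * f x"
  by (induction n) (simp_all add: fn_zero fn_add ring_distribs)

lemma fn_approx: "c < f x \<Longrightarrow> \<exists>x'. x' \<lless> x \<and> c < f x'"
proof -
  assume "c < f x"
  obtain X where X: "incseq X" "\<And>n. X n \<lless> x" "is_seq_sup X x" using way_below_seq[of x] by blast
  from \<open>c < f x\<close> obtain n where "c < f (X n)" using fn_sup[OF X(1,3)] by (auto simp: less_SUP_iff)
  with X(2) show ?thesis by blast
qed

lemma fn_leI: "(\<And>x'. x' \<lless> x \<Longrightarrow> f x' \<le> c) \<Longrightarrow> f x \<le> c"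
  using fn_approx by (meson leD leI)

lemma fn_approx_add:
  assumes "f x < top" "0 < (e::real)"
  obtains x' where "x' \<lless> x" "f x \<le> f x' + e"
proof (cases "f x = 0")
  case True
  then show ?thesis using that[of 0] by simp
next
  case False
  then have "f x - e < f x"
    using assms by (metis bot.not_eq_extremum bot_ennreal ennreal_between ennreal_eq_0_iff infinity_ennreal_def
        linorder_not_le top.not_eq_extremum)
  then obtain x' where "x' \<lless> x" "f x - e < f x'" using fn_approx by blast
  then show ?thesis using that by (metis add.commute ennreal_minus_le_iff less_imp_le)
qed

end

lemma functionals_add:
  assumes "f \<in> functionals" "g \<in> functionals"
  shows "(\<lambda>x. f x + g x) \<in> functionals"
proof -
  have "f s + g s = (SUP n. f (X n) + g (X n))" if X: "incseq X" "is_seq_sup X s" for X s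
  proof -
    have "incseq (\<lambda>n. f (X n))" "incseq (\<lambda>n. g (X n))"
      using X(1) fn_mono[OF assms(1)] fn_mono[OF assms(2)] by (auto simp: incseq_def)
    then show ?thesis using fn_sup[OF assms(1) X] fn_sup[OF assms(2) X] by (simp add: ennreal_SUP_add)
  qed
  then show ?thesis unfolding functionals_def
    using assms by (auto simp: fn_zero fn_add fn_mono mono_def add_mono ac_simps)
qed

lemma functionals_cmult:
  assumes "f \<in> functionals"
  shows "(\<lambda>x. c * f x) \<in> functionals"
  unfolding functionals_def using assms
  by (auto simp: fn_zero fn_add fn_mono mono_def mult_left_mono ring_distribs fn_sup SUP_mult_left_ennreal)

lemma functionals_zero: "(\<lambda>x. 0) \<in> functionals"
  unfolding functionals_def by (auto simp: mono_def)

section \<open>Regularization of additive maps\<close>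

lemma SUP_add_least_ennreal:
  fixes f :: "'i \<Rightarrow> ennreal" and g :: "'j \<Rightarrow> ennreal"
  assumes "A \<noteq> {}" "B \<noteq> {}" "\<And>i j. i \<in> A \<Longrightarrow> j \<in> B \<Longrightarrow> f i + g j \<le> c"
  shows "(SUP i\<in>A. f i) + (SUP j\<in>B. g j) \<le> c"
proof -
  have "(SUP i\<in>A. f i) + (SUP j\<in>B. g j) = (SUP j\<in>B. SUP i\<in>A. f i + g j)"
    using assms by (simp add: ennreal_SUP_add_left ennreal_SUP_add_right)
  also have "\<dots> \<le> c" using assms(3) by (intro SUP_least)
  finally show ?thesis .
qed

text \<open>Pointwise limits of functionals can lose preservation of suprema; this restores it.
  Splitting below a sum gives subadditivity, (O3) superadditivity, and interpolation
  continuity.\<close>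

lemma regularization_functional:
  fixes g :: "'a::cu_semigroup \<Rightarrow> ennreal"
  assumes "g 0 = 0" "\<And>x y. g (x + y) = g x + g y" "\<And>x y. x \<le> y \<Longrightarrow> g x \<le> g y"
  shows "(\<lambda>x. SUP x'\<in>{x'. x' \<lless> x}. g x') \<in> functionals" (is "?r \<in> _")
proof (rule functionalsI)
  have "x' \<lless> 0 \<Longrightarrow> x' = 0" for x' :: 'a
    using way_below_imp_le by (metis order_antisym pom_zero_le)
  then show "?r 0 = 0" using assms(1) by (metis (mono_tags, lifting) SUP_least le_zero_eq mem_Collect_eq order_refl)
  show "?r x \<le> ?r y" if "x \<le> y" for x y
    by (rule SUP_subset_mono) (use that way_below_trans2 in auto)
  show "?r (x + y) = ?r x + ?r y" for x y
  proof (rule antisym)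
    show "?r (x + y) \<le> ?r x + ?r y"
    proof (rule SUP_least)
      fix v assume "v \<in> {x'. x' \<lless> x + y}"
      then obtain x' y' where *: "x' \<lless> x" "y' \<lless> y" "v \<le> x' + y'" using way_below_add_split by blast
      have "g v \<le> g x' + g y'" using *(3) assms(2,3) by metis
      also have "\<dots> \<le> ?r x + ?r y" using *(1,2) by (intro add_mono SUP_upper) auto
      finally show "g v \<le> ?r x + ?r y" .
    qed
    have ne: "{x'. x' \<lless> z} \<noteq> {}" for z :: 'a using zero_way_below by blast
    show "?r x + ?r y \<le> ?r (x + y)"
      by (rule SUP_add_least_ennreal[OF ne ne])
        (auto simp: assms(2)[symmetric] intro!: SUP_upper O3)
  qed
  show "?r x \<le> c" if *: "\<And>x'. x' \<lless> x \<Longrightarrow> ?r x' \<le> c" for x c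
  proof (rule SUP_least)
    fix v assume "v \<in> {x'. x' \<lless> x}"
    then obtain w where w: "v \<lless> w" "w \<lless> x" using way_below_interpolate by blast
    have "g v \<le> ?r w" using w by (auto intro!: SUP_upper)
    also have "\<dots> \<le> c" using * w by blast
    finally show "g v \<le> c" .
  qed
qed

section \<open>Usable forms of the axioms, and limiting inequalities\<close>

lemma O5_complement:
  assumes "cu_O5 TYPE('a::cu_semigroup)" "x' \<lless> x" "x \<le> (y::'a)"
  obtains z where "x' + z \<le> y" "y \<le> x + z"
proof -
  \<comment> \<open>This is the case \<open>w' = w = 0\<close> of (O5).\<close>
  have "x + 0 \<le> y" using assms(3) by simp
  then have "\<exists>z. x' + z \<le> y \<and> y \<le> x + z \<and> 0 \<lless> z"
    using assms(1,2) assms(3) zero_way_below unfolding cu_O5_def by blast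
  then show ?thesis using that by blast
qed

lemma O6_split:
  assumes "cu_O6 TYPE('a::cu_semigroup)" "x' \<lless> x" "(x::'a) \<le> y + z"
  obtains y' z' where "x' \<le> y' + z'" "y' \<le> x" "y' \<le> y" "z' \<le> x" "z' \<le> z"
  using assms unfolding cu_O6_def by blast

lemma O7_upper:
  assumes "cu_O7 TYPE('a::cu_semigroup)" "x1' \<lless> x1" "x1 \<le> w" "x2' \<lless> x2" "x2 \<le> (w::'a)"
  obtains x where "x1' \<lless> x" "x2' \<lless> x" "x \<le> w" "x \<le> x1 + x2"
  using assms unfolding cu_O7_def by blast

lemma archimedean_le_ennreal:
  fixes x y C :: ennreal
  assumes "C < top" "\<And>n. of_nat n * x \<le> of_nat n * y + C"
  shows "x \<le> y"
proof (rule ccontr)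
  assume "\<not> x \<le> y"
  then have "y < x" by simp
  \<comment> \<open>\<open>d\<close> is finite even if \<open>x\<close> is infinite, so the
    comparison takes place in the reals.\<close>
  then obtain d where d: "y < d" "d < x" using dense by blast
  define r s c where "r = enn2real y" and "s = enn2real d" and "c = enn2real C"
  have "y < top" "d < top" using d by (meson order_less_le_trans top_greatest)+
  then have y: "y = ennreal r" "0 \<le> r" and dd: "d = ennreal s" "0 \<le> s" and C: "C = ennreal c" "0 \<le> c"
    using assms(1) by (auto simp: r_def s_def c_def)
  have "r < s" using d y dd by (simp add: ennreal_less_iff)
  then obtain n where n: "c < of_nat n * (s - r)" by (meson ex_less_of_nat_mult diff_gt_0_iff_gt)
  have "of_nat n * d \<le> of_nat n * y + C"
    using assms(2)[of n] mult_left_mono[of d x "of_nat n"] d(2) by (meson less_imp_le order_trans zero_le)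
  then have "ennreal (real n * s) \<le> ennreal (real n * r + c)"
    using y dd C by (simp add: ennreal_mult ennreal_plus ennreal_of_nat_eq_real_of_nat)
  then have "real n * s \<le> real n * r + c" using y C by (subst (asm) ennreal_le_iff) auto
  with n show False by (simp add: algebra_simps)
qed

lemma epsilon_cmult_le_ennreal:
  fixes x y :: ennreal
  assumes "\<And>e::real. 0 < e \<Longrightarrow> x \<le> y + of_nat k * ennreal e"
  shows "x \<le> y"
proof (rule ennreal_le_epsilon)
  fix e :: real assume "0 < e"
  have "x \<le> y + of_nat k * ennreal (e / (k + 1))" using assms \<open>0 < e\<close> by simp
  also have "of_nat k * ennreal (e / (k + 1)) = ennreal (real k * (e / (k + 1)))"
    using \<open>0 < e\<close> by (simp add: ennreal_mult[symmetric] ennreal_of_nat_eq_real_of_nat)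
  also have "\<dots> \<le> ennreal e"
    using \<open>0 < e\<close> by (intro ennreal_leI) (simp add: field_simps)
  finally show "x \<le> y + ennreal e" by (simp add: add_left_mono)
qed

section \<open>Residuals and Riesz decomposition\<close>

text \<open>This is the supremum of \<open>(a u - l u) / n\<close> over \<open>u \<le> n z\<close> with \<open>l u \<le> a u\<close>, written without
  truncated subtraction. Passing to multiples \<open>n z\<close> makes up for the missing cancellation in the
  semigroup: an error that is independent of \<open>n\<close> disappears after division by \<open>n\<close>.\<close>

definition residual :: "('a::cu_semigroup \<Rightarrow> ennreal) \<Rightarrow> ('a \<Rightarrow> ennreal) \<Rightarrow> 'a \<Rightarrow> ennreal" where
  "residual a l z = Sup {d. \<exists>n u. 0 < n \<and> u \<le> n \<odot> z \<and> l u < top \<and> a u = l u + of_nat n * d}"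

text \<open>Since \<open>l u\<close> is finite, it cancels from
  \<open>a u = l u + of_nat n * d\<close>; a bound on the residual thus becomes an inequality
  without subtraction.\<close>

lemma residual_leI:
  assumes "\<And>n u. 0 < n \<Longrightarrow> u \<le> n \<odot> z \<Longrightarrow> l u < top \<Longrightarrow> a u \<le> l u + of_nat n * c"
  shows "residual a l z \<le> c"
  unfolding residual_def
proof (rule Sup_least, clarify)
  fix d n u assume *: "0 < n" "u \<le> n \<odot> z" "l u < top" "a u = l u + of_nat n * d"
  with assms have "l u + of_nat n * d \<le> l u + of_nat n * c" by metis
  then have "of_nat n * d \<le> of_nat n * c" using *(3) by (auto simp: ennreal_add_left_cancel_le)
  then show "d \<le> c" using *(1) by (simp add: ennreal_mult_le_mult_iff)
qed

text \<open>If \<open>a u\<close> exceeds \<open>l u\<close>, their difference divided by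
  \<open>n\<close> is one of the \<open>d\<close> in the definition.\<close>

lemma le_residual:
  assumes "0 < n" "u \<le> n \<odot> z" "l u < top"
  shows "a u \<le> l u + of_nat n * residual a l z"
proof (cases "a u \<le> l u")
  case True
  then show ?thesis by (meson add_increasing2 zero_le)
next
  case False
  define d where "d = (a u - l u) / of_nat n"
  have "of_nat n * d = a u - l u"
    using assms(1) unfolding d_def
    by (simp add: ennreal_times_divide mult.commute[of "of_nat n"] mult_divide_eq_ennreal)
  then have eq: "a u = l u + of_nat n * d"
    using False by (auto simp: add_diff_self_ennreal)
  then have "d \<le> residual a l z" unfolding residual_def using assms by (intro Sup_upper) blast
  then show ?thesis by (subst eq) (intro add_left_mono mult_left_mono, auto)
qed

lemma residual_mono: "x \<le> y \<Longrightarrow> residual a l x \<le> residual a l y"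
  unfolding residual_def by (rule Sup_subset_mono) (auto intro: order_trans[OF _ nmult_mono])

lemma residual_nmult_le:
  assumes "0 < n"
  shows "residual a l (n \<odot> z) \<le> of_nat n * residual a l z"
proof (rule residual_leI)
  fix m u assume "0 < m" "u \<le> m \<odot> n \<odot> z" "l u < top"
  then have "a u \<le> l u + of_nat (m * n) * residual a l z"
    using assms by (intro le_residual) (simp_all add: nmult_mult)
  then show "a u \<le> l u + of_nat m * (of_nat n * residual a l z)" by (simp add: mult.assoc)
qed

text \<open>Both defining sets contain 0, hence are nonempty, so the sum of the two suprema is
  bounded as soon as all sums \<open>d + e\<close> are.\<close>

lemma residual_add_leI:
  assumes fn: "a \<in> functionals" "l \<in> functionals" "b \<in> functionals" "k \<in> functionals"
    and le: "\<And>n u d m v e. 0 < n \<Longrightarrow> u \<le> n \<odot> x \<Longrightarrow> l u < top \<Longrightarrow> a u = l u + of_nat n * d \<Longrightarrow>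
      0 < m \<Longrightarrow> v \<le> m \<odot> y \<Longrightarrow> k v < top \<Longrightarrow> b v = k v + of_nat m * e \<Longrightarrow> d + e \<le> c"
  shows "residual a l x + residual b k y \<le> c"
proof -
  let ?D = "\<lambda>a l z. {d. \<exists>n u. 0 < n \<and> u \<le> n \<odot> z \<and> l u < top \<and> a u = l u + of_nat n * d}"
  have ne: "?D a l z \<noteq> {}" if "a \<in> functionals" "l \<in> functionals" for a l z
  proof -
    have "0 < (1::nat) \<and> 0 \<le> 1 \<odot> z \<and> l 0 < top \<and> a 0 = l 0 + of_nat 1 * 0"
      using that by (simp add: fn_zero pom_zero_le)
    then show ?thesis by blast
  qed
  have "(SUP d\<in>?D a l x. d) + (SUP e\<in>?D b k y. e) \<le> c"
    by (rule SUP_add_least_ennreal[OF ne[OF fn(1,2)] ne[OF fn(3,4)]]) (use le in blast)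
  then show ?thesis by (simp add: residual_def)
qed

context
  fixes a l :: "'a::cu_semigroup \<Rightarrow> ennreal"
  assumes O5: "cu_O5 TYPE('a)" and O6: "cu_O6 TYPE('a)"
    and a: "a \<in> functionals" and l: "l \<in> functionals"
begin

text \<open>(O6) splits almost all of \<open>u\<close> into \<open>a1 \<le> z1\<close> and
  \<open>a2 \<le> z2\<close>. Adding the estimates for these pieces could count \<open>l\<close>
  twice where they overlap, so \<open>a1\<close> is replaced by a complement \<open>c\<close> of
  \<open>a2\<close> in \<open>u\<close>, for which \<open>l b + l c \<le> l u\<close>.\<close>

lemma residual_split_finite:
  assumes u: "u \<le> z1 + z2" and fin: "l u < top" "a u < top"
  shows "a u \<le> l u + (residual a l z1 + residual a l z2)"
proof (rule epsilon_cmult_le_ennreal[where k=3])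
  fix e :: real assume e: "0 < e"
  \<comment> \<open>The chain \<open>u3 \<lless> u2 \<lless> u1 \<lless> u\<close> leaves room for
    (O6) at \<open>u1\<close>, the passage from \<open>a2\<close> to \<open>b\<close> at
    \<open>u2\<close>, and (O5) at \<open>u3\<close>.\<close>
  obtain u3 where u3: "u3 \<lless> u" "a u \<le> a u3 + e" using fn_approx_add[OF a fin(2) e] by blast
  obtain u2 where u2: "u3 \<lless> u2" "u2 \<lless> u" using way_below_interpolate u3(1) by blast
  obtain u1 where u1: "u2 \<lless> u1" "u1 \<lless> u" using way_below_interpolate u2(2) by blast
  obtain a1 a2 where s: "u1 \<le> a1 + a2" "a1 \<le> u" "a1 \<le> z1" "a2 \<le> u" "a2 \<le> z2"
    using O6_split[OF O6 u1(2) u] by metis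
  have la2: "l a2 < top" using s(4) fin(1) fn_mono[OF l] by (meson order_le_less_trans)
  obtain b0 where b0: "b0 \<lless> a2" "l a2 \<le> l b0 + e" using fn_approx_add[OF l la2 e] by blast
  \<comment> \<open>\<open>b\<close> is far enough up in \<open>a2\<close> to keep its
    \<open>l\<close> value up to \<open>e\<close> and to cover \<open>u2\<close> together with
    \<open>a1\<close>.\<close>
  obtain b where b: "b0 \<le> b" "b \<lless> a2" "u2 \<le> a1 + b"
  proof -
    obtain X where X: "incseq X" "\<And>n. X n \<lless> a2" "is_seq_sup X a2" using way_below_seq[of a2] by blast
    obtain n where n: "b0 \<le> X n" using way_belowD[OF b0(1) X(1,3)] by auto
    have "is_seq_sup (\<lambda>n. a1 + X n) (a1 + a2)"
      by (rule O4) (use X in \<open>auto simp: is_seq_sup_def\<close>)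
    moreover have "incseq (\<lambda>n. a1 + X n)" using X(1) by (simp add: incseq_def add_left_mono)
    ultimately obtain m where m: "u2 \<le> a1 + X m" using way_belowD[OF u1(1) _ _ s(1)] by blast
    have "b0 \<le> X (max n m)" "u2 \<le> a1 + X (max n m)"
      using n m X(1) by (meson add_left_mono incseqD max.cobounded1 max.cobounded2 order_trans)+
    with X(2) that show ?thesis by blast
  qed
  obtain c where c: "b + c \<le> u" "u \<le> a2 + c" using O5_complement[OF O5 b(2) s(4)] by blast
  \<comment> \<open>\<open>r\<close> is the rest of \<open>u\<close> beyond \<open>u2\<close>; as
    \<open>u3\<close> carries \<open>a u\<close> up to \<open>e\<close>, \<open>a r\<close> is at
    most \<open>e\<close>.\<close>
  obtain r where r: "u3 + r \<le> u" "u \<le> u2 + r"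
    using O5_complement[OF O5 u2(1) way_below_imp_le[OF u2(2)]] by blast
  have "a u3 + a r \<le> a u3 + e"
    using fn_mono[OF a r(1)] u3(2) fn_add[OF a] by (metis order_trans)
  moreover have "a u3 < top"
    using fn_mono[OF a way_below_imp_le[OF u3(1)]] fin(2) by (meson order_le_less_trans)
  ultimately have ar: "a r \<le> e" by (auto simp: ennreal_add_left_cancel_le)
  have ab: "a b \<le> a u" by (meson a b(2) fn_mono order_trans s(4) way_below_imp_le)
  have lc: "l c \<le> l u" by (meson c(1) fn_mono l le_add_right order_trans)
  have step: "c + b \<le> (a1 + r) + b"
  proof -
    have "c + b \<le> u2 + r" using c(1) r(2) by (metis add.commute order_trans)
    also have "\<dots> \<le> (a1 + b) + r" using b(3) by (rule add_right_mono)
    finally show ?thesis by (simp add: ac_simps)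
  qed
  \<comment> \<open>\<open>c\<close> plays the role of \<open>u - a2\<close>; since \<open>b\<close> cannot be cancelled, \<open>N c\<close> is compared with \<open>N a1\<close>
    up to the single copy of \<open>b\<close>.\<close>
  have steps: "N \<odot> c + b \<le> N \<odot> (a1 + r) + b" for N
  proof (induction N)
    case (Suc N)
    have "Suc N \<odot> c + b = N \<odot> c + (c + b)" by (simp add: ac_simps)
    also have "\<dots> \<le> N \<odot> c + ((a1 + r) + b)" using step by (rule add_left_mono)
    also have "\<dots> = (N \<odot> c + b) + (a1 + r)" by (simp add: ac_simps)
    also have "\<dots> \<le> (N \<odot> (a1 + r) + b) + (a1 + r)" using Suc by (rule add_right_mono)
    finally show ?case by (simp add: ac_simps)
  qed simp
  \<comment> \<open>The single copy of \<open>b\<close> costs at most \<open>a u\<close>, which is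
    finite and independent of \<open>N\<close>.\<close>
  have "a c \<le> l c + residual a l z1 + e"
  proof (rule archimedean_le_ennreal[OF fin(2)])
    fix N
    show "of_nat N * a c \<le> of_nat N * (l c + residual a l z1 + ennreal e) + a u"
    proof (cases "N = 0")
      case False
      have Nc: "N \<odot> c \<le> N \<odot> a1 + (N \<odot> r + b)"
        using steps[of N] le_add_left[of "N \<odot> c" b] by (simp add: nmult_add ac_simps)
      have "a (N \<odot> c) \<le> of_nat N * (l c + residual a l z1 + ennreal e) + a u"
      proof (rule fn_leI[OF a])
        fix v assume "v \<lless> N \<odot> c"
        then obtain s' t' where st: "v \<le> s' + t'" "s' \<le> N \<odot> c" "s' \<le> N \<odot> a1" "t' \<le> N \<odot> r + b"
          using O6_split[OF O6 _ Nc] by metis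
        \<comment> \<open>\<open>s'\<close> lies below \<open>N \<odot> c\<close>, which makes
          \<open>l s'\<close> finite, and below \<open>N \<odot> a1\<close>, which lets
          \<open>residual a l z1\<close> control \<open>a s'\<close>.\<close>
        have ls: "l s' \<le> of_nat N * l c" using fn_mono[OF l st(2)] by (simp add: fn_nmult[OF l])
        also have "\<dots> < top" using lc fin(1) by (simp add: ennreal_mult_less_top of_nat_less_top order_le_less_trans)
        finally have lt: "l s' < top" .
        have "s' \<le> N \<odot> z1" using st(3) nmult_mono[OF s(3)] order_trans by blast
        then have as: "a s' \<le> l s' + of_nat N * residual a l z1"
          using False lt by (intro le_residual) auto
        have "a t' \<le> of_nat N * a r + a b"
          using fn_le_add[OF a st(4)] by (simp add: fn_nmult[OF a])
        also have "\<dots> \<le> of_nat N * ennreal e + a u" using ar ab by (intro add_mono mult_left_mono) auto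
        finally have at: "a t' \<le> of_nat N * ennreal e + a u" .
        have "a v \<le> a s' + a t'" using fn_le_add[OF a st(1)] .
        also have "\<dots> \<le> (of_nat N * l c + of_nat N * residual a l z1) + (of_nat N * ennreal e + a u)"
          using as ls at by (meson add_mono order_refl order_trans)
        finally show "a v \<le> of_nat N * (l c + residual a l z1 + ennreal e) + a u"
          by (simp add: ring_distribs ac_simps)
      qed
      then show ?thesis by (simp add: fn_nmult[OF a])
    qed simp
  qed
  moreover have "a a2 \<le> l a2 + of_nat 1 * residual a l z2"
    using s(5) la2 by (intro le_residual) auto
  then have "a a2 \<le> (l b + e) + residual a l z2"
    using b0(2) fn_mono[OF l b(1)]
    by (metis (no_types, lifting) add_right_mono mult_1 of_nat_1 order_trans)
  moreover have "a u \<le> a a2 + a c" using fn_le_add[OF a c(2)] .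
  ultimately have "a u \<le> ((l b + e) + residual a l z2) + (l c + residual a l z1 + e)"
    by (meson add_mono order_trans)
  also have "\<dots> = (l b + l c) + (residual a l z1 + residual a l z2) + of_nat 2 * ennreal e"
    by (simp add: ac_simps mult_2_right)
  also have "\<dots> \<le> l u + (residual a l z1 + residual a l z2) + of_nat 3 * ennreal e"
    using fn_mono[OF l c(1)] fn_add[OF l, of b c] by (intro add_mono mult_right_mono) auto
  finally show "a u \<le> l u + (residual a l z1 + residual a l z2) + of_nat 3 * ennreal e" .
qed

text \<open>Finiteness of \<open>a u\<close> is dropped by testing on \<open>v \<lless> u\<close>:
  if \<open>a v\<close> is infinite, one piece of an (O6) splitting has infinite \<open>a\<close>
  but finite \<open>l\<close>, so the residual at \<open>z1\<close> or \<open>z2\<close> is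
  infinite.\<close>

lemma residual_split:
  assumes u: "u \<le> z1 + z2" and fin: "l u < top"
  shows "a u \<le> l u + (residual a l z1 + residual a l z2)"
proof (rule fn_leI[OF a])
  fix v assume v: "v \<lless> u"
  have lv: "l v \<le> l u" using v by (simp add: fn_mono[OF l] way_below_imp_le)
  show "a v \<le> l u + (residual a l z1 + residual a l z2)"
  proof (cases "a v < top")
    case True
    have "a v \<le> l v + (residual a l z1 + residual a l z2)"
      using u v lv fin True by (intro residual_split_finite) (auto dest: way_below_imp_le)
    then show ?thesis using lv by (meson add_right_mono order_trans)
  next
    case False
    obtain u1 u2 where s: "v \<le> u1 + u2" "u1 \<le> u" "u1 \<le> z1" "u2 \<le> u" "u2 \<le> z2"
      using O6_split[OF O6 v u] by metis
    have lu: "l u1 < top" "l u2 < top" using s fin fn_mono[OF l] by (meson order_le_less_trans)+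
    have "a u1 \<le> l u1 + of_nat 1 * residual a l z1" "a u2 \<le> l u2 + of_nat 1 * residual a l z2"
      using s lu by (intro le_residual; simp)+
    moreover have "a v \<le> a u1 + a u2" using fn_le_add[OF a s(1)] .
    ultimately have "residual a l z1 = top \<or> residual a l z2 = top"
      using False lu by (auto simp: less_top[symmetric] top_unique ennreal_add_eq_top)
    then show ?thesis by auto
  qed
qed

lemma residual_functional: "residual a l \<in> functionals"
proof (rule functionalsI)
  show "residual a l 0 = 0"
  proof -
    have "residual a l 0 \<le> 0"
    proof (rule residual_leI)
      fix n u assume "u \<le> n \<odot> (0::'a)"
      then have "u = 0" by (simp add: order_antisym pom_zero_le)
      then show "a u \<le> l u + of_nat n * 0" by (simp add: fn_zero[OF a])
    qed
    then show ?thesis by simp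
  qed
  show "x \<le> y \<Longrightarrow> residual a l x \<le> residual a l y" for x y by (rule residual_mono)
  show "residual a l (z1 + z2) = residual a l z1 + residual a l z2" for z1 z2
  proof (rule antisym)
    show "residual a l (z1 + z2) \<le> residual a l z1 + residual a l z2"
    proof (rule residual_leI)
      fix n u assume *: "0 < n" "u \<le> n \<odot> (z1 + z2)" "l u < top"
      then have "a u \<le> l u + (residual a l (n \<odot> z1) + residual a l (n \<odot> z2))"
        by (intro residual_split) (simp_all add: nmult_add)
      also have "\<dots> \<le> l u + (of_nat n * residual a l z1 + of_nat n * residual a l z2)"
        using *(1) by (intro add_left_mono add_mono residual_nmult_le)
      finally show "a u \<le> l u + of_nat n * (residual a l z1 + residual a l z2)"
        by (simp add: ring_distribs)
    qed
    show "residual a l z1 + residual a l z2 \<le> residual a l (z1 + z2)"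
    proof (rule residual_add_leI[OF a l a l])
      fix n u d1 m v d2
      assume *: "0 < n" "u \<le> n \<odot> z1" "l u < top" "a u = l u + of_nat n * d1"
        "0 < m" "v \<le> m \<odot> z2" "l v < top" "a v = l v + of_nat m * d2"
      \<comment> \<open>For superadditivity, two witnesses with denominators \<open>n\<close> and
        \<open>m\<close> are brought to the common denominator \<open>m * n\<close>.\<close>
      have "m \<odot> u + n \<odot> v \<le> m \<odot> n \<odot> z1 + n \<odot> m \<odot> z2"
        using * by (intro add_mono nmult_mono)
      also have "\<dots> = (m * n) \<odot> (z1 + z2)"
        by (simp add: nmult_mult nmult_add) (metis mult.commute nmult_mult)
      finally have "m \<odot> u + n \<odot> v \<le> (m * n) \<odot> (z1 + z2)" .
      moreover have "l (m \<odot> u + n \<odot> v) < top"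
        using * by (simp add: fn_add[OF l] fn_nmult[OF l] ennreal_mult_less_top of_nat_less_top)
      moreover have "a (m \<odot> u + n \<odot> v) = l (m \<odot> u + n \<odot> v) + of_nat (m * n) * (d1 + d2)"
        using * by (simp add: fn_add[OF l] fn_nmult[OF l] fn_add[OF a] fn_nmult[OF a] ring_distribs ac_simps)
      moreover have "0 < m * n" using * by simp
      ultimately show "d1 + d2 \<le> residual a l (z1 + z2)"
        unfolding residual_def by (intro Sup_upper) blast
    qed
  qed
  show "residual a l x \<le> c" if *: "\<And>x'. x' \<lless> x \<Longrightarrow> residual a l x' \<le> c" for x c
  proof (rule residual_leI)
    fix n u assume u: "0 < n" "u \<le> n \<odot> x" "l u < top"
    show "a u \<le> l u + of_nat n * c"
    proof (rule fn_leI[OF a])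
      fix v assume v: "v \<lless> u"
      then have lv: "l v \<le> l u" by (simp add: fn_mono[OF l] way_below_imp_le)
      obtain x' where x': "x' \<lless> x" "v \<le> n \<odot> x'"
        using way_below_nmult_split way_below_trans2[OF v u(2)] by blast
      have "a v \<le> l v + of_nat n * residual a l x'" using u x' lv by (intro le_residual) auto
      also have "\<dots> \<le> l u + of_nat n * c" using lv *[OF x'(1)] by (intro add_mono mult_left_mono) auto
      finally show "a v \<le> l u + of_nat n * c" .
    qed
  qed
qed

end

section \<open>Residuals as differences of functionals\<close>

lemma residual_add_ge: "a z \<le> l z + residual a l z"
proof (cases "l z < top")
  case True
  then show ?thesis using le_residual[of 1 z z l a] by simp
qed (simp add: less_top[symmetric])

lemma residual_least:
  assumes m: "m \<in> functionals" and le: "\<And>z. a z \<le> l z + m z"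
  shows "residual a l z \<le> m z"
proof (rule residual_leI)
  fix n u assume "u \<le> n \<odot> z"
  then have "m u \<le> of_nat n * m z" using fn_mono[OF m] fn_nmult[OF m] by metis
  then show "a u \<le> l u + of_nat n * m z" using le[of u] by (meson add_left_mono order_trans)
qed

text \<open>This is monotonicity of \<open>a - n\<close> without subtraction. A complement
  \<open>c\<close> of \<open>u\<close> in \<open>w\<close> satisfies \<open>n c \<le> a c\<close>,
  and (O5) supplies it up to \<open>u' \<lless> u\<close>.\<close>

lemma functional_diff_mono:
  assumes O5: "cu_O5 TYPE('a::cu_semigroup)" and a: "a \<in> functionals" and n: "n \<in> functionals"
    and le: "\<And>z. n z \<le> a z" and uw: "u \<le> (w::'a)"
  shows "a u + n w \<le> n u + a w"
proof -
  have *: "a u' + n w \<le> n u + a w" if u': "u' \<lless> u" for u'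
  proof -
    obtain c where c: "u' + c \<le> w" "w \<le> u + c" using O5_complement[OF O5 u' uw] by blast
    have "a u' + n w \<le> a u' + (n u + a c)"
      using fn_le_add[OF n c(2)] le[of c] by (meson add_left_mono order_trans)
    also have "\<dots> = n u + (a u' + a c)" by (simp add: ac_simps)
    also have "\<dots> \<le> n u + a w" using fn_mono[OF a c(1)] fn_add[OF a] by (metis add_left_mono)
    finally show ?thesis .
  qed
  obtain X where X: "incseq X" "\<And>k. X k \<lless> u" "is_seq_sup X u" using way_below_seq[of u] by blast
  have "a u + n w = (SUP k. a (X k) + n w)" using fn_sup[OF a X(1,3)] by (simp add: ennreal_SUP_add_left)
  also have "\<dots> \<le> n u + a w" using * X(2) by (intro SUP_least) auto
  finally show ?thesis .
qed

lemma residual_add_eq: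
  assumes O5: "cu_O5 TYPE('a::cu_semigroup)" and a: "a \<in> functionals" and n: "n \<in> functionals"
    and le: "\<And>z. n z \<le> a z"
  shows "n (z::'a) + residual a n z = a z"
proof (rule antisym)
  show "a z \<le> n z + residual a n z" by (rule residual_add_ge)
  show "n z + residual a n z \<le> a z"
  proof (cases "n z < top")
    case True
    \<comment> \<open>Monotonicity of \<open>a - n\<close> along \<open>u \<le> k \<odot> z\<close>
      gives the bound after cancelling the finite term \<open>n z\<close>.\<close>
    have "residual a n z \<le> a z - n z"
    proof (rule residual_leI)
      fix k u assume k: "0 < k" "u \<le> k \<odot> z" "n u < top"
      have "a u + of_nat k * n z \<le> n u + of_nat k * a z"
        using functional_diff_mono[OF O5 a n le k(2)] by (simp add: fn_nmult[OF a] fn_nmult[OF n])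
      also have "\<dots> = (n u + of_nat k * (a z - n z)) + of_nat k * n z"
        using le[of z] by (metis add.assoc diff_add_self_ennreal distrib_left)
      finally show "a u \<le> n u + of_nat k * (a z - n z)"
        using True by (auto simp: add.commute[of _ "of_nat k * n z"] ennreal_add_left_cancel_le ennreal_mult_eq_top_iff)
    qed
    then have "n z + residual a n z \<le> n z + (a z - n z)" by (rule add_left_mono)
    then show ?thesis using le[of z] by (simp add: add_diff_self_ennreal)
  next
    case False
    then have "a z = top" using le[of z] by (simp add: less_top[symmetric] top_unique)
    then show ?thesis by simp
  qed
qed

text \<open>\<open>residual a l\<close> is the part of \<open>a\<close> not covered by
  \<open>l\<close>, so by minimality it lies below \<open>m\<close> and below \<open>a\<close>. Its
  complement in \<open>a\<close> is again a residual and, also by minimality, lies below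
  \<open>l\<close>.\<close>

lemma riesz_decomposition:
  assumes O5: "cu_O5 TYPE('a::cu_semigroup)" and O6: "cu_O6 TYPE('a)"
    and fn: "a \<in> functionals" "l \<in> functionals" "m \<in> functionals"
    and le: "\<And>z::'a. a z \<le> l z + m z"
  obtains a1 a2 where "a1 \<in> functionals" "a2 \<in> functionals" "a = (\<lambda>z. a1 z + a2 z)"
    "\<And>z. a1 z \<le> l z" "\<And>z. a2 z \<le> m z"
proof -
  let ?p = "residual a l"
  have p: "?p \<in> functionals" using residual_functional O5 O6 fn by blast
  have q: "residual a ?p \<in> functionals" using residual_functional O5 O6 fn p by blast
  have pm: "?p z \<le> m z" for z using residual_least fn(3) le by blast
  have ql: "residual a ?p z \<le> l z" for z
    by (rule residual_least[OF fn(2)]) (metis add.commute residual_add_ge)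
  have "?p z \<le> a z" for z by (rule residual_least[OF fn(1)]) (simp add: add_increasing)
  then have "a = (\<lambda>z. residual a ?p z + ?p z)"
    using residual_add_eq[OF O5 fn(1) p] by (metis add.commute)
  then show ?thesis using that[OF q p _ ql pm] by blast
qed

section \<open>Closed ideals\<close>

text \<open>The closure of \<open>G\<close> under smaller elements and suprema of increasing
  sequences; an ideal when \<open>G\<close> contains 0 and is closed under addition.\<close>

definition closed_ideal :: "'a::cu_semigroup set \<Rightarrow> 'a set" where
  "closed_ideal G = {z. \<forall>z'. z' \<lless> z \<longrightarrow> (\<exists>g\<in>G. z' \<le> g)}"

lemma closed_ideal_downward: "x \<le> y \<Longrightarrow> y \<in> closed_ideal G \<Longrightarrow> x \<in> closed_ideal G"
  unfolding closed_ideal_def using way_below_trans2 by blast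

lemma closed_idealI: "z \<le> g \<Longrightarrow> g \<in> G \<Longrightarrow> z \<in> closed_ideal G"
  unfolding closed_ideal_def by (blast intro: order_trans dest: way_below_imp_le)

lemma closed_idealD: "z \<in> closed_ideal G \<Longrightarrow> z' \<lless> z \<Longrightarrow> \<exists>g\<in>G. z' \<le> g"
  unfolding closed_ideal_def by blast

lemma closed_ideal_closed:
  assumes "\<And>x'. x' \<lless> x \<Longrightarrow> x' \<in> closed_ideal G"
  shows "x \<in> closed_ideal G"
  unfolding closed_ideal_def
proof clarify
  fix z' assume "z' \<lless> x"
  then obtain w where "z' \<lless> w" "w \<lless> x" using way_below_interpolate by blast
  then show "\<exists>g\<in>G. z' \<le> g" using assms closed_idealD by blast
qed

definition infinite_off :: "'a set \<Rightarrow> ('a \<Rightarrow> ennreal) \<Rightarrow> 'a \<Rightarrow> ennreal" where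
  "infinite_off I f x = (if x \<in> I then f x else top)"

text \<open>Additivity holds because \<open>x + y\<close> lies in the ideal exactly when both
  summands do. For continuity, a finite bound on all \<open>x' \<lless> x\<close> puts them, and
  hence \<open>x\<close>, into the ideal.\<close>

lemma infinite_off_functional:
  assumes f: "f \<in> functionals" and G: "0 \<in> G" "\<And>g h. g \<in> G \<Longrightarrow> h \<in> G \<Longrightarrow> g + h \<in> G"
  shows "infinite_off (closed_ideal G) f \<in> functionals"
proof (rule functionalsI)
  show "infinite_off (closed_ideal G) f 0 = 0"
    using closed_idealI[of 0 0 G] G(1) by (simp add: infinite_off_def fn_zero[OF f])
  have "x + y \<in> closed_ideal G \<longleftrightarrow> x \<in> closed_ideal G \<and> y \<in> closed_ideal G" for x y
  proof
    assume "x + y \<in> closed_ideal G"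
    then show "x \<in> closed_ideal G \<and> y \<in> closed_ideal G"
      using closed_ideal_downward[OF le_add_left] closed_ideal_downward[OF le_add_right] by blast
  next
    assume xy: "x \<in> closed_ideal G \<and> y \<in> closed_ideal G"
    show "x + y \<in> closed_ideal G"
      unfolding closed_ideal_def
    proof clarify
      fix v assume "v \<lless> x + y"
      then obtain x' y' where v: "x' \<lless> x" "y' \<lless> y" "v \<le> x' + y'" using way_below_add_split by blast
      obtain g h where "g \<in> G" "h \<in> G" "x' \<le> g" "y' \<le> h" using xy v closed_idealD by blast
      then show "\<exists>g\<in>G. v \<le> g" using v(3) G(2) by (meson add_mono order_trans)
    qed
  qed
  then show "infinite_off (closed_ideal G) f (x + y)
      = infinite_off (closed_ideal G) f x + infinite_off (closed_ideal G) f y" for x y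
    by (simp add: infinite_off_def fn_add[OF f])
  show "x \<le> y \<Longrightarrow> infinite_off (closed_ideal G) f x \<le> infinite_off (closed_ideal G) f y" for x y
    using closed_ideal_downward[of x y G] by (simp add: infinite_off_def fn_mono[OF f])
  show "infinite_off (closed_ideal G) f x \<le> c"
    if *: "\<And>x'. x' \<lless> x \<Longrightarrow> infinite_off (closed_ideal G) f x' \<le> c" for x c
  proof (cases "c = top")
    case False
    then have "x' \<in> closed_ideal G" if "x' \<lless> x" for x'
      using *[OF that] by (auto simp: infinite_off_def top_unique split: if_splits)
    then have "x \<in> closed_ideal G" by (rule closed_ideal_closed)
    moreover have "f x \<le> c"
    proof (rule fn_leI[OF f])
      fix x' assume "x' \<lless> x"
      with * \<open>x \<in> closed_ideal G\<close> show "f x' \<le> c"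
        using closed_ideal_downward[OF way_below_imp_le] by (fastforce simp: infinite_off_def)
    qed
    ultimately show ?thesis by (simp add: infinite_off_def)
  qed simp
qed

section \<open>The infimum of two evaluation maps\<close>

definition decomposition_inf :: "'a::cu_semigroup \<Rightarrow> 'a \<Rightarrow> ('a \<Rightarrow> ennreal) \<Rightarrow> ennreal" where
  "decomposition_inf x y l =
     Inf {l1 x + l2 y |l1 l2. l1 \<in> functionals \<and> l2 \<in> functionals \<and> l = (\<lambda>w. l1 w + l2 w)}"

text \<open>Riesz decomposition shrinks a dominating pair to one with sum \<open>l\<close>. Hence
  functionals may be made infinite wherever this leaves the values at \<open>x\<close> and
  \<open>y\<close> unchanged.\<close>

lemma decomposition_inf_le:
  assumes O5: "cu_O5 TYPE('a::cu_semigroup)" and O6: "cu_O6 TYPE('a)"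
    and fn: "l \<in> functionals" "l1 \<in> functionals" "l2 \<in> functionals"
    and le: "\<And>z::'a. l z \<le> l1 z + l2 z"
  shows "decomposition_inf x y l \<le> l1 x + l2 y"
proof -
  obtain m1 m2 where m: "m1 \<in> functionals" "m2 \<in> functionals" "l = (\<lambda>z. m1 z + m2 z)"
    "\<And>z. m1 z \<le> l1 z" "\<And>z. m2 z \<le> l2 z"
    using riesz_decomposition[OF O5 O6 fn le] by blast
  have "decomposition_inf x y l \<le> m1 x + m2 y"
    unfolding decomposition_inf_def using m by (intro Inf_lower) auto
  also have "\<dots> \<le> l1 x + l2 y" using m by (intro add_mono)
  finally show ?thesis .
qed

text \<open>The formal identity \<open>(l - a1) + (m - a2) = b\<close> is made rigorous by
  cancelling \<open>a\<close>. This takes an element with finite \<open>a\<close> that serves both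
  residuals at once, which (O7) provides.\<close>

lemma decomposition_inf_add_le:
  assumes O5: "cu_O5 TYPE('a::cu_semigroup)" and O6: "cu_O6 TYPE('a)" and O7: "cu_O7 TYPE('a)"
    and fn: "l \<in> functionals" "m \<in> functionals" "a \<in> functionals" "b \<in> functionals"
    and eq: "\<And>z::'a. l z + m z = a z + b z"
  shows "decomposition_inf x y l + decomposition_inf x y m \<le> a x + b y"
proof (cases "a x = top")
  case False
  define G where "G = range (\<lambda>n. n \<odot> x)"
  have G: "0 \<in> G" "\<And>g h. g \<in> G \<Longrightarrow> h \<in> G \<Longrightarrow> g + h \<in> G"
    unfolding G_def using rangeI[of "\<lambda>n. n \<odot> x" 0] by (auto simp: nmult_add_left[symmetric])
  have x: "x \<in> closed_ideal G"
    by (rule closed_idealI[of _ "1 \<odot> x"]) (simp, unfold G_def, rule rangeI)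
  have fin: "a w < top" if "w \<le> n \<odot> x" for w n
  proof -
    have "a w \<le> of_nat n * a x" using fn_mono[OF fn(3) that] by (simp add: fn_nmult[OF fn(3)])
    also have "\<dots> < top" using False by (simp add: ennreal_mult_less_top of_nat_less_top less_top)
    finally show ?thesis .
  qed
  have "a z \<le> l z + m z" for z unfolding eq by simp
  then obtain a1 a2 where a12: "a1 \<in> functionals" "a2 \<in> functionals" "a = (\<lambda>z. a1 z + a2 z)"
    "\<And>z. a1 z \<le> l z" "\<And>z. a2 z \<le> m z"
    using riesz_decomposition[OF O5 O6 fn(3,1,2)] by blast
  \<comment> \<open>The values at \<open>x\<close> do not change, but the residuals now test only
    elements of the ideal; whatever is way below these lies under a multiple of \<open>x\<close> and
    has finite \<open>a\<close>.\<close>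
  define c1 c2 where "c1 = infinite_off (closed_ideal G) a1" and "c2 = infinite_off (closed_ideal G) a2"
  have c: "c1 \<in> functionals" "c2 \<in> functionals"
    unfolding c1_def c2_def using infinite_off_functional a12 G by blast+
  define d1 d2 where "d1 = residual l c1" and "d2 = residual m c2"
  have d: "d1 \<in> functionals" "d2 \<in> functionals"
    unfolding d1_def d2_def using residual_functional[OF O5 O6] fn c by blast+
  have "decomposition_inf x y l \<le> c1 x + d1 y"
    using residual_add_ge c d fn O5 O6 unfolding d1_def by (intro decomposition_inf_le)
  moreover have "decomposition_inf x y m \<le> c2 x + d2 y"
    using residual_add_ge c d fn O5 O6 unfolding d2_def by (intro decomposition_inf_le)
  moreover have "c1 x + c2 x = a x"
    using x a12(3) by (simp add: c1_def c2_def infinite_off_def)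
  moreover have "d1 y + d2 y \<le> b y"
  proof -
    show ?thesis unfolding d1_def d2_def
    proof (rule residual_add_leI[OF fn(1) c(1) fn(2) c(2)])
      fix n u e1 k v e2
      assume u: "0 < n" "u \<le> n \<odot> y" "c1 u < top" "l u = c1 u + of_nat n * e1"
        and v: "0 < k" "v \<le> k \<odot> y" "c2 v < top" "m v = c2 v + of_nat k * e2"
      \<comment> \<open>Common multiples give both test elements the same bound
        \<open>N \<odot> y\<close>, as (O7) requires.\<close>
      define N U V where "N = k * n" and "U = k \<odot> u" and "V = n \<odot> v"
      have N: "0 < N" "U \<le> N \<odot> y" "V \<le> N \<odot> y"
        using u v nmult_mono[OF u(2), of k] nmult_mono[OF v(2), of n]
        by (auto simp: N_def U_def V_def nmult_mult[symmetric] mult.commute)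
      have U: "c1 U < top" "l U = c1 U + of_nat N * e1"
        using u by (simp_all add: U_def N_def fn_nmult[OF c(1)] fn_nmult[OF fn(1)]
            ennreal_mult_less_top of_nat_less_top ring_distribs mult.assoc)
      have V: "c2 V < top" "m V = c2 V + of_nat N * e2"
        using v by (simp_all add: V_def N_def fn_nmult[OF c(2)] fn_nmult[OF fn(2)]
            ennreal_mult_less_top of_nat_less_top ring_distribs mult_ac)
      have UG: "U \<in> closed_ideal G" "c1 U = a1 U" and VG: "V \<in> closed_ideal G" "c2 V = a2 V"
        using U V by (auto simp: c1_def c2_def infinite_off_def split: if_splits)
      have key: "l u' + m v' \<le> a1 U + a2 V + of_nat N * b y" if "u' \<lless> U" "v' \<lless> V" for u' v'
      proof -
        obtain u2 where u2: "u' \<lless> u2" "u2 \<lless> U" using way_below_interpolate \<open>u' \<lless> U\<close> by blast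
        obtain v2 where v2: "v' \<lless> v2" "v2 \<lless> V" using way_below_interpolate \<open>v' \<lless> V\<close> by blast
        obtain i where i: "u2 \<le> i \<odot> x" using closed_idealD[OF UG(1) u2(2)] by (auto simp: G_def)
        obtain j where j: "v2 \<le> j \<odot> x" using closed_idealD[OF VG(1) v2(2)] by (auto simp: G_def)
        \<comment> \<open>The bound \<open>u2 + v2\<close> puts \<open>w\<close> under a multiple of
          \<open>x\<close>, so that \<open>a w\<close> is finite.\<close>
        obtain w where w: "u' \<lless> w" "v' \<lless> w" "w \<le> N \<odot> y" "w \<le> u2 + v2"
          using O7_upper[OF O7 u2(1) order_trans[OF way_below_imp_le[OF u2(2)] N(2)]
              v2(1) order_trans[OF way_below_imp_le[OF v2(2)] N(3)]] by blast
        have "w \<le> (i + j) \<odot> x" using order_trans[OF w(4) add_mono[OF i j]] by (simp add: nmult_add_left)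
        then have aw: "a w < top" by (rule fin)
        have l1: "l u' + a1 w \<le> a1 u' + l w"
          by (rule functional_diff_mono[OF O5 fn(1) a12(1,4) way_below_imp_le[OF w(1)]])
        have m1: "m v' + a2 w \<le> a2 v' + m w"
          by (rule functional_diff_mono[OF O5 fn(2) a12(2,5) way_below_imp_le[OF w(2)]])
        \<comment> \<open>\<open>a w = a1 w + a2 w\<close> is added to combine the two monotone
          differences and cancelled at the end.\<close>
        have "(l u' + m v') + a w = (l u' + a1 w) + (m v' + a2 w)"
          by (simp add: a12(3) ac_simps)
        also have "\<dots> \<le> (a1 u' + l w) + (a2 v' + m w)" using l1 m1 by (rule add_mono)
        also have "\<dots> = (a1 u' + a2 v') + (l w + m w)" by (simp add: ac_simps)
        also have "\<dots> = (a1 u' + a2 v' + b w) + a w" unfolding eq by (simp add: ac_simps)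
        finally have "l u' + m v' \<le> a1 u' + a2 v' + b w"
          using aw by (auto simp: add.commute[of _ "a w"] ennreal_add_left_cancel_le)
        also have "\<dots> \<le> a1 U + a2 V + of_nat N * b y"
          using fn_mono[OF fn(4) w(3)] that
          by (intro add_mono fn_mono[OF a12(1)] fn_mono[OF a12(2)])
            (simp_all add: fn_nmult[OF fn(4)] way_below_imp_le)
        finally show ?thesis .
      qed
      obtain X where X: "incseq X" "\<And>n. X n \<lless> U" "is_seq_sup X U" using way_below_seq[of U] by blast
      obtain Y where Y: "incseq Y" "\<And>n. Y n \<lless> V" "is_seq_sup Y V" using way_below_seq[of V] by blast
      have "l U + m V \<le> a1 U + a2 V + of_nat N * b y"
        unfolding fn_sup[OF fn(1) X(1,3)] fn_sup[OF fn(2) Y(1,3)]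
        by (rule SUP_add_least_ennreal) (use key X Y in auto)
      then have "(a1 U + a2 V) + of_nat N * (e1 + e2) \<le> (a1 U + a2 V) + of_nat N * b y"
        using U V UG VG by (simp add: ring_distribs ac_simps)
      moreover have "a1 U + a2 V \<noteq> top" using U(1) V(1) UG(2) VG(2) by auto
      ultimately have "of_nat N * (e1 + e2) \<le> of_nat N * b y"
        by (auto simp: ennreal_add_left_cancel_le)
      then show "e1 + e2 \<le> b y" using N(1) by (simp add: ennreal_mult_le_mult_iff)
    qed
  qed
  ultimately have "decomposition_inf x y l + decomposition_inf x y m \<le> (c1 x + d1 y) + (c2 x + d2 y)"
    "(c1 x + c2 x) + (d1 y + d2 y) \<le> a x + b y"
    by (simp_all add: add_mono)
  then show ?thesis by (simp add: ac_simps)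
qed simp

section \<open>Subadditivity and homogeneity of the infimum\<close>

lemma decomposition_inf_approx:
  assumes "decomposition_inf x y l < c"
  obtains l1 l2 where "l1 \<in> functionals" "l2 \<in> functionals" "l = (\<lambda>z. l1 z + l2 z)" "l1 x + l2 y < c"
  using assms unfolding decomposition_inf_def by (auto simp: Inf_less_iff)

lemma less_add_epsilon_ennreal: "x < top \<Longrightarrow> 0 < e \<Longrightarrow> x < x + ennreal e"
  using ennreal_add_left_cancel_less[of x 0 "ennreal e"] by auto

lemma decomposition_inf_subadditive:
  assumes "l \<in> functionals" "m \<in> functionals"
  shows "decomposition_inf x y (\<lambda>z. l z + m z) \<le> decomposition_inf x y l + decomposition_inf x y m"
proof (rule epsilon_cmult_le_ennreal[where k=2])
  fix e :: real assume e: "0 < e"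
  show "decomposition_inf x y (\<lambda>z. l z + m z)
      \<le> decomposition_inf x y l + decomposition_inf x y m + of_nat 2 * ennreal e"
  proof (cases "decomposition_inf x y l < top \<and> decomposition_inf x y m < top")
    case True
    then have "decomposition_inf x y l < decomposition_inf x y l + e"
      "decomposition_inf x y m < decomposition_inf x y m + e"
      using e by (simp_all add: less_add_epsilon_ennreal)
    then obtain l1 l2 m1 m2 where l: "l1 \<in> functionals" "l2 \<in> functionals" "l = (\<lambda>z. l1 z + l2 z)"
      "l1 x + l2 y < decomposition_inf x y l + e"
      and m: "m1 \<in> functionals" "m2 \<in> functionals" "m = (\<lambda>z. m1 z + m2 z)"
      "m1 x + m2 y < decomposition_inf x y m + e"
      by (elim decomposition_inf_approx) blast
    have "decomposition_inf x y (\<lambda>z. l z + m z) \<le> (l1 x + m1 x) + (l2 y + m2 y)"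
      unfolding decomposition_inf_def
    proof (rule Inf_lower, rule CollectI, intro exI conjI)
      show "(\<lambda>z. l1 z + m1 z) \<in> functionals" "(\<lambda>z. l2 z + m2 z) \<in> functionals"
        using l m by (simp_all add: functionals_add)
    qed (simp_all add: l m ac_simps)
    also have "\<dots> = (l1 x + l2 y) + (m1 x + m2 y)" by (simp add: ac_simps)
    also have "\<dots> \<le> (decomposition_inf x y l + e) + (decomposition_inf x y m + e)"
      using l(4) m(4) by (intro add_mono less_imp_le)
    finally show ?thesis by (simp add: ac_simps mult_2_right)
  next
    case False
    then show ?thesis by (auto simp: less_top[symmetric])
  qed
qed

lemma decomposition_inf_cmult_le:
  assumes "l \<in> functionals" "0 < (c::real)"
  shows "decomposition_inf x y (\<lambda>z. ennreal c * l z) \<le> ennreal c * decomposition_inf x y l"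
proof -
  \<comment> \<open>After division by \<open>c\<close> the claim is a lower bound for an infimum,
    and decompositions of \<open>l\<close> can be scaled one by one.\<close>
  have "decomposition_inf x y (\<lambda>z. ennreal c * l z) / ennreal c \<le> decomposition_inf x y l"
    unfolding decomposition_inf_def[of x y l]
  proof (rule Inf_greatest, clarify)
    fix l1 l2 :: "'a \<Rightarrow> ennreal" assume *: "l1 \<in> functionals" "l2 \<in> functionals" "l = (\<lambda>w. l1 w + l2 w)"
    have "decomposition_inf x y (\<lambda>z. ennreal c * l z) \<le> ennreal c * l1 x + ennreal c * l2 y"
      unfolding decomposition_inf_def
    proof (rule Inf_lower, rule CollectI, intro exI conjI)
      show "(\<lambda>z. ennreal c * l1 z) \<in> functionals" "(\<lambda>z. ennreal c * l2 z) \<in> functionals"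
        using * by (simp_all add: functionals_cmult)
    qed (simp_all add: * ring_distribs)
    then show "decomposition_inf x y (\<lambda>z. ennreal c * (l1 z + l2 z)) / ennreal c \<le> l1 x + l2 y"
      using assms(2) * by (intro divide_le_posI_ennreal) (simp_all add: ring_distribs mult.commute)
  qed
  then have "ennreal c * (decomposition_inf x y (\<lambda>z. ennreal c * l z) / ennreal c)
      \<le> ennreal c * decomposition_inf x y l" by (rule mult_left_mono) simp
  then show ?thesis
    using assms(2) by (simp add: ennreal_times_divide mult.commute[of "ennreal c"] mult_divide_eq_ennreal)
qed

lemma decomposition_inf_cmult:
  assumes "l \<in> functionals" "0 < (c::real)"
  shows "decomposition_inf x y (\<lambda>z. ennreal c * l z) = ennreal c * decomposition_inf x y l"
proof (rule antisym[OF decomposition_inf_cmult_le[OF assms]])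
  have inv: "ennreal c * (ennreal (1 / c) * t) = t" for t
    using assms(2) by (simp add: mult.assoc[symmetric] ennreal_mult[symmetric])
  then have inv': "ennreal (1 / c) * (ennreal c * t) = t" for t by (simp add: mult.left_commute)
  \<comment> \<open>The reverse inequality is the one already shown, for \<open>1 / c\<close> and
    the functional \<open>c l\<close>.\<close>
  have "decomposition_inf x y l \<le> ennreal (1 / c) * decomposition_inf x y (\<lambda>z. ennreal c * l z)"
    using decomposition_inf_cmult_le[OF functionals_cmult[OF assms(1), of "ennreal c"], of "1 / c" x y]
      assms(2) by (simp add: inv')
  then have "ennreal c * decomposition_inf x y l
      \<le> ennreal c * (ennreal (1 / c) * decomposition_inf x y (\<lambda>z. ennreal c * l z))"
    by (rule mult_left_mono) simp
  then show "ennreal c * decomposition_inf x y l \<le> decomposition_inf x y (\<lambda>z. ennreal c * l z)"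
    by (simp add: inv)
qed

lemma decomposition_inf_zero: "decomposition_inf x y (\<lambda>_. 0) = 0"
proof -
  have "decomposition_inf x y (\<lambda>_. 0) \<le> (\<lambda>_. 0) x + (\<lambda>_. 0) y"
    unfolding decomposition_inf_def
    by (rule Inf_lower, rule CollectI, intro exI conjI, rule refl) (simp_all add: functionals_zero)
  then show ?thesis by simp
qed

text \<open>Decompositions with one summand 0 give the upper bounds by \<open>hat x\<close> and
  \<open>hat y\<close>, and a linear minorant \<open>k\<close> satisfies
  \<open>k l1 + k l2 \<le> l1 x + l2 y\<close>; the substance is superadditivity.\<close>

lemma is_linear_inf_decomposition_inf:
  assumes O5: "cu_O5 TYPE('a::cu_semigroup)" and O6: "cu_O6 TYPE('a)" and O7: "cu_O7 TYPE('a)"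
  shows "is_linear_inf (hat x) (hat (y::'a)) (decomposition_inf x y)"
  unfolding is_linear_inf_def
proof (intro conjI ballI allI impI)
  show "linear_on_functionals (decomposition_inf x y)"
    unfolding linear_on_functionals_def
  proof (intro conjI ballI allI impI decomposition_inf_zero decomposition_inf_cmult antisym
      decomposition_inf_subadditive)
    fix l m :: "'a \<Rightarrow> ennreal" assume lm: "l \<in> functionals" "m \<in> functionals"
    show "decomposition_inf x y l + decomposition_inf x y m \<le> decomposition_inf x y (\<lambda>z. l z + m z)"
      unfolding decomposition_inf_def[of x y "\<lambda>z. l z + m z"]
    proof (rule Inf_greatest, clarify)
      fix a b :: "'a \<Rightarrow> ennreal"
      assume ab: "a \<in> functionals" "b \<in> functionals" and eq: "(\<lambda>z. l z + m z) = (\<lambda>z. a z + b z)"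
      from eq have "l z + m z = a z + b z" for z by (rule fun_cong)
      then show "decomposition_inf x y l + decomposition_inf x y m \<le> a x + b y"
        by (rule decomposition_inf_add_le[OF O5 O6 O7 lm ab])
    qed
  qed
next
  fix l :: "'a \<Rightarrow> ennreal" assume l: "l \<in> functionals"
  have "decomposition_inf x y l \<le> l x + (\<lambda>_. 0) y"
    by (rule decomposition_inf_le[OF O5 O6 l l functionals_zero]) simp
  then show "decomposition_inf x y l \<le> hat x l" by (simp add: hat_def)
  have "decomposition_inf x y l \<le> (\<lambda>_. 0) x + l y"
    by (rule decomposition_inf_le[OF O5 O6 l functionals_zero l]) simp
  then show "decomposition_inf x y l \<le> hat y l" by (simp add: hat_def)
next
  fix k :: "('a \<Rightarrow> ennreal) \<Rightarrow> ennreal" and l :: "'a \<Rightarrow> ennreal"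
  assume k: "linear_on_functionals k \<and> (\<forall>l\<in>functionals. k l \<le> hat x l \<and> k l \<le> hat y l)"
    and l: "l \<in> functionals"
  show "k l \<le> decomposition_inf x y l"
    unfolding decomposition_inf_def
  proof (rule Inf_greatest, clarify)
    fix l1 l2 :: "'a \<Rightarrow> ennreal" assume *: "l1 \<in> functionals" "l2 \<in> functionals"
    then have "k (\<lambda>w. l1 w + l2 w) = k l1 + k l2" using k by (simp add: linear_on_functionals_def)
    also have "\<dots> \<le> l1 x + l2 y" using k * by (auto simp: hat_def intro: add_mono)
    finally show "k (\<lambda>w. l1 w + l2 w) \<le> l1 x + l2 y" .
  qed
qed

section \<open>Limits of decompositions\<close>

text \<open>Each factor \<open>ennreal\<close> is compact, so Tychonoff's theorem applies to
  pointwise convergence.\<close>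

lemma compact_UNIV_fun_ennreal: "compact (UNIV :: ('i \<Rightarrow> ennreal) set)"
proof -
  have "compact_space (product_topology (\<lambda>i. euclidean :: ennreal topology) (UNIV :: 'i set))"
    by (simp add: compact_space_product_topology) (simp add: compact_space_def compact_UNIV)
  then show ?thesis
    by (simp add: euclidean_product_topology compact_space_def)
qed

lemma way_below_directed:
  assumes "x \<lless> z" "y \<lless> (z::'a::cu_semigroup)"
  obtains w where "w \<lless> z" "x \<le> w" "y \<le> w"
proof -
  obtain X where X: "incseq X" "\<And>n. X n \<lless> z" "is_seq_sup X z" using way_below_seq[of z] by blast
  obtain n where n: "x \<le> X n" using way_belowD[OF assms(1) X(1,3)] by auto
  obtain m where m: "y \<le> X m" using way_belowD[OF assms(2) X(1,3)] by auto
  have "x \<le> X (max n m)" "y \<le> X (max n m)"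
    using n m X(1) by (meson incseqD max.cobounded1 max.cobounded2 order_trans)+
  with X(2) that show ?thesis by blast
qed

text \<open>Pairs of additive monotone maps with sum \<open>l\<close> form a compact set, in which
  the bounds indexed by \<open>D\<close> are closed conditions with the finite intersection
  property.\<close>

lemma decomposition_limit:
  fixes l :: "'a::cu_semigroup \<Rightarrow> ennreal"
  assumes l: "l \<in> functionals"
    and fip: "\<And>F. finite F \<Longrightarrow> F \<subseteq> D \<Longrightarrow> \<exists>l1 l2. l1 \<in> functionals \<and> l2 \<in> functionals \<and>
      l = (\<lambda>z. l1 z + l2 z) \<and> (\<forall>(z, w)\<in>F. l1 z + l2 w \<le> c)"
  obtains l1 l2 where "l1 \<in> functionals" "l2 \<in> functionals" "l = (\<lambda>z. l1 z + l2 z)"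
    "\<And>z w. (z, w) \<in> D \<Longrightarrow> l1 z + l2 w \<le> c"
proof -
  \<comment> \<open>A pair of maps is one map on \<open>bool \<times> 'a\<close>. Preservation of
    suprema is left out, as it need not be a closed condition.\<close>
  define S where "S = {h :: bool \<times> 'a \<Rightarrow> ennreal. (\<forall>i. h (i, 0) = 0) \<and>
    (\<forall>i x y. h (i, x + y) = h (i, x) + h (i, y)) \<and> (\<forall>i x y. x \<le> y \<longrightarrow> h (i, x) \<le> h (i, y)) \<and>
    (\<forall>z. h (True, z) + h (False, z) = l z)}"
  define C where "C = (\<lambda>(z, w). {h :: bool \<times> 'a \<Rightarrow> ennreal. h (True, z) + h (False, w) \<le> c})"
  have imp: "closed {h :: bool \<times> 'a \<Rightarrow> ennreal. x \<le> y \<longrightarrow> h (i, x) \<le> h (i, y)}" for i x y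
    by (cases "x \<le> y") (auto intro: closed_Collect_le)
  have "closed S" unfolding S_def
    by (intro closed_Collect_conj closed_Collect_all closed_Collect_eq imp
        continuous_on_add continuous_on_const continuous_on_product_coordinates)
  then have "compact S" using closed_Int_compact[OF _ compact_UNIV_fun_ennreal, of S] by simp
  moreover have "closed (C p)" for p
    unfolding C_def split_def
    by (intro closed_Collect_le continuous_on_add continuous_on_const continuous_on_product_coordinates)
  moreover have "S \<inter> (\<Inter>p\<in>F. C p) \<noteq> {}" if "finite F" "F \<subseteq> D" for F
  proof -
    obtain l1 l2 where *: "l1 \<in> functionals" "l2 \<in> functionals" "l = (\<lambda>z. l1 z + l2 z)"
      "\<forall>(z, w)\<in>F. l1 z + l2 w \<le> c" using fip[OF \<open>finite F\<close> \<open>F \<subseteq> D\<close>] by blast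
    have "(\<lambda>(i, z). if i then l1 z else l2 z) \<in> S \<inter> (\<Inter>p\<in>F. C p)"
      using * unfolding S_def C_def by (auto simp: fn_zero fn_add fn_mono)
    then show ?thesis by blast
  qed
  ultimately have "S \<inter> (\<Inter>p\<in>D. C p) \<noteq> {}" by (rule compact_imp_fip_image)
  then obtain h where h: "h \<in> S" "\<And>p. p \<in> D \<Longrightarrow> h \<in> C p" by blast
  \<comment> \<open>Regularizing keeps the sum equal to \<open>l\<close>, since \<open>l\<close> is
    determined by its values way below, and only lowers the maps, so the bounds on \<open>D\<close>
    survive.\<close>
  define r where "r i x = (SUP x'\<in>{x'. x' \<lless> x}. h (i, x'))" for i x
  have r: "r i \<in> functionals" for i
    unfolding r_def by (rule regularization_functional) (use h(1) in \<open>auto simp: S_def\<close>)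
  have mono: "x \<le> y \<Longrightarrow> h (i, x) \<le> h (i, y)" for i x y using h(1) by (auto simp: S_def)
  have sum: "h (True, z) + h (False, z) = l z" for z using h(1) by (auto simp: S_def)
  have le: "r i x \<le> h (i, x)" for i x
    unfolding r_def by (rule SUP_least) (auto intro: mono way_below_imp_le)
  have ge: "z' \<lless> z \<Longrightarrow> h (i, z') \<le> r i z" for i z z' unfolding r_def by (rule SUP_upper) simp
  have "l z = r True z + r False z" for z
  proof (rule antisym)
    show "l z \<le> r True z + r False z"
      by (rule fn_leI[OF l]) (simp add: sum[symmetric] add_mono ge)
    show "r True z + r False z \<le> l z" using le add_mono sum by metis
  qed
  moreover have "r True z + r False w \<le> c" if "(z, w) \<in> D" for z w
  proof -
    have "r True z + r False w \<le> h (True, z) + h (False, w)" by (intro add_mono le)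
    also have "\<dots> \<le> c" using h(2)[OF that] by (simp add: C_def)
    finally show ?thesis .
  qed
  ultimately show ?thesis using that[OF r r] by blast
qed

text \<open>(O6) splits off one copy of \<open>x\<close> at a time: the piece below \<open>x\<close>
  costs \<open>M\<close>, and the rest stays below \<open>v\<close>, so the bound \<open>M\<close>
  remains available for it.\<close>

lemma functional_le_of_nmult_add:
  assumes O6: "cu_O6 TYPE('a::cu_semigroup)" and f: "f \<in> functionals"
    and v: "v \<le> n \<odot> x + (b::'a)" and M: "\<And>t. t \<le> x \<Longrightarrow> t \<le> v \<Longrightarrow> f t \<le> M"
  shows "f v \<le> of_nat n * M + f b"
  using v M
proof (induction n arbitrary: v)
  case 0
  then show ?case using fn_mono[OF f] by simp
next
  case (Suc n)
  show ?case
  proof (rule fn_leI[OF f])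
    fix v' assume v': "v' \<lless> v"
    have "v \<le> x + (n \<odot> x + b)" using Suc.prems(1) by (simp add: ac_simps)
    from O6_split[OF O6 v' this]
    obtain p q where s: "v' \<le> p + q" "p \<le> v" "p \<le> x" "q \<le> v" "q \<le> n \<odot> x + b" by metis
    have "f q \<le> of_nat n * M + f b"
      by (rule Suc.IH[OF s(5)]) (use Suc.prems(2) s(4) order_trans in blast)
    moreover have "f p \<le> M" using Suc.prems(2) s by blast
    moreover have "f v' \<le> f p + f q" by (rule fn_le_add[OF f s(1)])
    ultimately have "f v' \<le> M + (of_nat n * M + f b)" by (meson add_mono order_trans)
    then show "f v' \<le> of_nat (Suc n) * M + f b" by (simp add: ring_distribs ac_simps)
  qed
qed

text \<open>The margin \<open>z1 \<lless> z0\<close> is the room that (O7) needs at the next step;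
  its bound \<open>u \<le> z0 + a\<close> keeps the value of \<open>l\<close> finite.\<close>

lemma finite_part_directed:
  assumes O7: "cu_O7 TYPE('a::cu_semigroup)" and l: "l \<in> functionals"
    and "finite F" "\<And>z. z \<in> F \<Longrightarrow> \<exists>a. z \<lless> a \<and> a \<le> x \<and> l a < top"
  shows "\<exists>z0 z1. z1 \<lless> z0 \<and> z0 \<le> (x::'a) \<and> l z0 < top \<and> (\<forall>z\<in>F. z \<le> z1)"
  using assms(3,4)
proof (induction F rule: finite_induct)
  case empty
  have "(0::'a) \<lless> 0 \<and> 0 \<le> x \<and> l 0 < top" by (simp add: pom_zero_le fn_zero[OF l])
  then show ?case by blast
next
  case (insert z F)
  then obtain z0 z1 where z: "z1 \<lless> z0" "z0 \<le> x" "l z0 < top" "\<forall>z\<in>F. z \<le> z1" by blast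
  obtain a where a: "z \<lless> a" "a \<le> x" "l a < top" using insert by blast
  obtain u where u: "z1 \<lless> u" "z \<lless> u" "u \<le> x" "u \<le> z0 + a"
    using O7_upper[OF O7 z(1,2) a(1,2)] by blast
  obtain w where w: "w \<lless> u" "z1 \<le> w" "z \<le> w" using way_below_directed[OF u(1,2)] by blast
  have "l u < top" using fn_le_add[OF l u(4)] z(3) a(3) by (simp add: order_le_less_trans)
  with u w z(4) show ?case by (blast intro: order_trans)
qed

theorem theorem4p7:
  fixes l :: "'a::cu_semigroup \<Rightarrow> ennreal"
  assumes "cu_O5 TYPE('a)" and "cu_O6 TYPE('a)" and "cu_O7 TYPE('a)"
    and "l \<in> functionals"
    and "\<And>x y. l x < \<infinity> \<Longrightarrow> l y < \<infinity> \<Longrightarrow>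
           linear_inf (hat x) (hat y) l \<le> Sup {l z |z. z \<le> x \<and> z \<le> y}"
  shows "edwards_condition l"
proof -
  note O5 = assms(1) and O6 = assms(2) and O7 = assms(3) and l = assms(4)
  \<comment> \<open>By uniqueness of the linear infimum on functionals, the hypothesis speaks of
    \<open>decomposition_inf\<close>.\<close>
  have finite_case: "decomposition_inf x y l \<le> Sup {l z |z. z \<le> x \<and> z \<le> y}"
    if "l x < top" "l y < top" for x y
    using assms(5)[of x y] linear_inf_eq[OF is_linear_inf_decomposition_inf[OF O5 O6 O7] l] that by simp
  have main: "decomposition_inf x y l \<le> Sup {l z |z. z \<le> x \<and> z \<le> y}" (is "_ \<le> ?s") for x y
  proof (rule ennreal_le_epsilon)
    fix e :: real assume s: "?s < top" and e: "0 < e"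
    \<comment> \<open>The margin between \<open>z\<close> and \<open>a\<close> is what (O7) uses
      when finitely many components are bounded together.\<close>
    define D where "D = {(z, w). (\<exists>a. z \<lless> a \<and> a \<le> x \<and> l a < top) \<and> (\<exists>a. w \<lless> a \<and> a \<le> y \<and> l a < top)}"
    obtain l1 l2 where l12: "l1 \<in> functionals" "l2 \<in> functionals" "l = (\<lambda>z. l1 z + l2 z)"
      and D: "\<And>z w. (z, w) \<in> D \<Longrightarrow> l1 z + l2 w \<le> ?s + e"
    proof (rule decomposition_limit[OF l, of D "?s + e"])
      fix F assume F: "finite F" "F \<subseteq> D"
      obtain z0 z1 where z: "z1 \<lless> z0" "z0 \<le> x" "l z0 < top" "\<forall>z\<in>fst ` F. z \<le> z1"
      proof -
        have "\<exists>a. z \<lless> a \<and> a \<le> x \<and> l a < top" if "z \<in> fst ` F" for z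
          using that F by (auto simp: D_def)
        then show ?thesis
          using finite_part_directed[OF O7 l, of "fst ` F" x] F(1) that by blast
      qed
      obtain w0 w1 where w: "w1 \<lless> w0" "w0 \<le> y" "l w0 < top" "\<forall>z\<in>snd ` F. z \<le> w1"
      proof -
        have "\<exists>a. z \<lless> a \<and> a \<le> y \<and> l a < top" if "z \<in> snd ` F" for z
          using that F by (auto simp: D_def)
        then show ?thesis
          using finite_part_directed[OF O7 l, of "snd ` F" y] F(1) that by blast
      qed
      \<comment> \<open>\<open>z0\<close> and \<open>w0\<close> have finite value and dominate all
        components of \<open>F\<close>, so one near-optimal decomposition for them serves all of
        \<open>F\<close>.\<close>
      have "decomposition_inf z0 w0 l \<le> Sup {l z |z. z \<le> z0 \<and> z \<le> w0}" using finite_case z w by blast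
      also have "\<dots> \<le> ?s" using z(2) w(2) by (intro Sup_subset_mono) (auto intro: order_trans)
      also have "\<dots> < ?s + e" using s e by (rule less_add_epsilon_ennreal)
      finally obtain l1 l2 where *: "l1 \<in> functionals" "l2 \<in> functionals" "l = (\<lambda>z. l1 z + l2 z)"
        "l1 z0 + l2 w0 < ?s + e" by (rule decomposition_inf_approx)
      have "l1 a + l2 b \<le> ?s + e" if "(a, b) \<in> F" for a b
      proof -
        have "a \<le> z0" "b \<le> w0"
          using z(1,4) w(1,4) that by (force dest: way_below_imp_le intro: order_trans)+
        then have "l1 a + l2 b \<le> l1 z0 + l2 w0" using * by (intro add_mono fn_mono)
        then show ?thesis using *(4) by simp
      qed
      with * show "\<exists>l1 l2. l1 \<in> functionals \<and> l2 \<in> functionals \<and> l = (\<lambda>z. l1 z + l2 z) \<and>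
          (\<forall>(z, w)\<in>F. l1 z + l2 w \<le> ?s + e)" by blast
    qed blast
    define A where "A x = {z. z \<le> x \<and> l z < top}" for x
    have A0: "0 \<in> A x" for x by (simp add: A_def pom_zero_le fn_zero[OF l])
    \<comment> \<open>The two components of \<open>D\<close> vary independently, so the suprema over
      \<open>A x\<close> and \<open>A y\<close> can be taken separately.\<close>
    have bound: "(SUP z\<in>A x. l1 z) + (SUP w\<in>A y. l2 w) \<le> ?s + e"
    proof (rule SUP_add_least_ennreal)
      fix z w assume zw: "z \<in> A x" "w \<in> A y"
      obtain X where X: "incseq X" "\<And>n. X n \<lless> z" "is_seq_sup X z" using way_below_seq[of z] by blast
      obtain Y where Y: "incseq Y" "\<And>n. Y n \<lless> w" "is_seq_sup Y w" using way_below_seq[of w] by blast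
      have "(X n, Y k) \<in> D" for n k
        using zw X(2)[of n] Y(2)[of k] unfolding D_def A_def by blast
      then show "l1 z + l2 w \<le> ?s + e"
        unfolding fn_sup[OF l12(1) X(1,3)] fn_sup[OF l12(2) Y(1,3)]
        by (intro SUP_add_least_ennreal D) auto
    qed (use A0 in auto)
    define J where "J = {a. l a < top}"
    have J: "0 \<in> J" "\<And>g h. g \<in> J \<Longrightarrow> h \<in> J \<Longrightarrow> g + h \<in> J"
      by (auto simp: J_def fn_zero[OF l] fn_add[OF l])
    \<comment> \<open>With \<open>t\<close> zero on the closed ideal of \<open>J\<close> and
      infinite elsewhere, \<open>residual f t\<close> keeps only the part of \<open>f\<close> seen
      on that ideal.\<close>
    define t where "t = infinite_off (closed_ideal J) (\<lambda>_. 0)"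
    have t: "t \<in> functionals" unfolding t_def by (rule infinite_off_functional[OF functionals_zero J])
    have tJ: "t z = 0" if "z \<in> closed_ideal J" for z using that by (simp add: t_def infinite_off_def)
    have le_SUP: "residual f t x \<le> (SUP z\<in>A x. f z)" if f: "f \<in> functionals" for f x
    proof (rule residual_leI)
      fix n u assume u: "0 < n" "u \<le> n \<odot> x" "t u < top"
      have "u \<in> closed_ideal J" using u(3) by (auto simp: t_def infinite_off_def split: if_splits)
      \<comment> \<open>It suffices to bound \<open>f\<close> on elements below both
        \<open>x\<close> and \<open>u\<close>; these are approximated by members of
        \<open>A x\<close> because \<open>u\<close> lies in the closed ideal of
        \<open>J\<close>.\<close>
      have "f u \<le> of_nat n * (SUP z\<in>A x. f z) + f 0"
      proof (rule functional_le_of_nmult_add[OF O6 f])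
        show "u \<le> n \<odot> x + 0" using u by simp
        fix v assume v: "v \<le> x" "v \<le> u"
        show "f v \<le> (SUP z\<in>A x. f z)"
        proof (rule fn_leI[OF f], rule SUP_upper)
          fix v' assume v': "v' \<lless> v"
          then obtain g where "l g < top" "v' \<le> g"
            using closed_idealD[OF \<open>u \<in> closed_ideal J\<close> way_below_trans2[OF v' v(2)]] by (auto simp: J_def)
          then have "l v' < top" using fn_mono[OF l] by (meson order_le_less_trans)
          then show "v' \<in> A x" using v(1) way_below_imp_le[OF v'] by (auto simp: A_def)
        qed
      qed
      then show "f u \<le> t u + of_nat n * (SUP z\<in>A x. f z)" by (simp add: fn_zero[OF f] add_increasing)
    qed
    \<comment> \<open>\<open>G x\<close> generates the ideal of \<open>x\<close> and all elements of
      finite value. Infinity off it leaves the value at \<open>x\<close> unchanged and makes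
      \<open>c1 + c2\<close> dominate \<open>l\<close> outside the two ideals.\<close>
    define G where "G x = {n \<odot> x + a |n a. l a < top}" for x
    have G: "0 \<in> G x" "\<And>g h. g \<in> G x \<Longrightarrow> h \<in> G x \<Longrightarrow> g + h \<in> G x" for x
    proof -
      have "l 0 < top" by (simp add: fn_zero[OF l])
      then have "0 \<odot> x + 0 \<in> G x" unfolding G_def by blast
      then show "0 \<in> G x" by simp
      fix g h assume "g \<in> G x" "h \<in> G x"
      then obtain n a m b where "g = n \<odot> x + a" "h = m \<odot> x + b" "l a < top" "l b < top"
        by (auto simp: G_def)
      then have "g + h = (n + m) \<odot> x + (a + b)" "l (a + b) < top"
        by (simp_all add: nmult_add_left fn_add[OF l] ac_simps)
      then show "g + h \<in> G x" unfolding G_def by blast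
    qed
    define c1 c2 where "c1 = infinite_off (closed_ideal (G x)) (residual l1 t)"
      and "c2 = infinite_off (closed_ideal (G y)) (residual l2 t)"
    have r: "residual l1 t \<in> functionals" "residual l2 t \<in> functionals"
      using residual_functional[OF O5 O6] l12 t by blast+
    have c: "c1 \<in> functionals" "c2 \<in> functionals"
      unfolding c1_def c2_def by (intro infinite_off_functional r G; assumption)+
    have "l z \<le> c1 z + c2 z" for z
    proof (cases "z \<in> closed_ideal (G x) \<and> z \<in> closed_ideal (G y)")
      case True
      have "v \<in> J" if v: "v \<lless> z" for v
      proof -
        obtain n a where a: "v \<le> n \<odot> x + a" "l a < top"
          using closed_idealD[OF conjunct1[OF True] v] by (auto simp: G_def)
        obtain m b where b: "v \<le> m \<odot> y + b" "l b < top"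
          using closed_idealD[OF conjunct2[OF True] v] by (auto simp: G_def)
        \<comment> \<open>A part \<open>p\<close> of \<open>v\<close> below \<open>x\<close> is also
          below \<open>m \<odot> y + b\<close>. Elements below both \<open>p\<close> and
          \<open>y\<close> have value at most \<open>?s\<close>, so the inner estimate bounds
          \<open>l p\<close>, the outer one \<open>l v\<close>, and finiteness of \<open>?s\<close>
          makes \<open>l v\<close> finite.\<close>
        have "l v \<le> of_nat n * (of_nat m * ?s + l b) + l a"
        proof (rule functional_le_of_nmult_add[OF O6 l a(1)])
          fix p assume p: "p \<le> x" "p \<le> v"
          show "l p \<le> of_nat m * ?s + l b"
            by (rule functional_le_of_nmult_add[OF O6 l order_trans[OF p(2) b(1)]])
              (use p(1) in \<open>auto intro!: Sup_upper intro: order_trans\<close>)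
        qed
        also have "\<dots> < top" using a(2) b(2) s by (simp add: ennreal_mult_less_top of_nat_less_top)
        finally show ?thesis by (simp add: J_def)
      qed
      then have "z \<in> closed_ideal J" unfolding closed_ideal_def by blast
      then have "l1 z \<le> residual l1 t z" "l2 z \<le> residual l2 t z"
        using residual_add_ge[of l1 z t] residual_add_ge[of l2 z t] tJ by auto
      then show ?thesis using True l12(3) by (simp add: c1_def c2_def infinite_off_def add_mono)
    qed (auto simp: c1_def c2_def infinite_off_def)
    then have "decomposition_inf x y l \<le> c1 x + c2 y" by (rule decomposition_inf_le[OF O5 O6 l c])
    also have "z \<in> closed_ideal (G z)" for z
    proof (rule closed_idealI)
      have "l 0 < top" by (simp add: fn_zero[OF l])
      then show "1 \<odot> z + 0 \<in> G z" unfolding G_def by blast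
    qed simp
    then have "c1 x + c2 y = residual l1 t x + residual l2 t y" by (simp add: c1_def c2_def infinite_off_def)
    also have "\<dots> \<le> (SUP z\<in>A x. l1 z) + (SUP w\<in>A y. l2 w)" using l12 by (intro add_mono le_SUP)
    also note bound
    finally show "decomposition_inf x y l \<le> ?s + e" .
  qed
  show ?thesis unfolding edwards_condition_def
  proof (intro allI antisym)
    fix x y
    show "Inf {l1 x + l2 y |l1 l2. l1 \<in> functionals \<and> l2 \<in> functionals \<and> l = (\<lambda>w. l1 w + l2 w)}
        \<le> Sup {l z |z. z \<le> x \<and> z \<le> y}"
      using main[of x y] by (simp add: decomposition_inf_def)
    show "Sup {l z |z. z \<le> x \<and> z \<le> y}
        \<le> Inf {l1 x + l2 y |l1 l2. l1 \<in> functionals \<and> l2 \<in> functionals \<and> l = (\<lambda>w. l1 w + l2 w)}"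
    proof (intro Sup_least Inf_greatest, clarify)
      fix z l1 l2 assume "z \<le> x" "z \<le> y" "l1 \<in> functionals" "l2 \<in> functionals" "l = (\<lambda>w. l1 w + l2 w)"
      then show "l1 z + l2 z \<le> l1 x + l2 y" by (intro add_mono fn_mono)
    qed
  qed
qed

end
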